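(* Let $G$ be a profinite subgroup of $S_\infty$ with orbit independence, and let $I$ be a Scott ideal with $\deg(T_G)\in I$. Then $G_I\preceq G$: for every first-order formula $\varphi(\bar x)$ in the language of groups and every tuple $\bar a$ from $G_I$, $G_I\models\varphi(\bar a)$ if and only if $G\models\varphi(\bar a)$.
   Context: $S_\infty$ is the group of all permutations of $\mathbb{N}$, with the topology of pointwise convergence; its profinite subgroups are exactly the closed subgroups all of whose orbits $\mathrm{orb}_G(n)=\{g(n):g\in G\}$ are finite. For a subgroup $G\le S_\infty$, $T_G\subseteq\mathbb{N}^{<\omega}$ is the tree of all strings of the form $g(0)g^{-1}(0)g(1)g^{-1}(1)\cdots g(n)g^{-1}(n)$ with $g\in G$, $n\in\mathbb{N}$. $\deg(T_G)$ is the Turing join of the degree of the set $T_G$ (under a fixed computable coding of $\mathbb{N}^{<\omega}$ with decidable immediate-predecessor relation) and the degree of the branching function giving the number of immediate successors of each node of $T_G$. The orbits of a profinite $G$ are enumerated as $O_{G,0}=\mathrm{orb}_G(0)$ and $O_{G,n+1}=$ the orbit of the least natural number not in any $O_{G,m}$, $m\le n$. $H_k=\{g\restriction O_{G,k}:g\in G\}$. $G$ has orbit independence if $G$ is isomorphic to $\prod_{k\in\mathbb{N}}H_k$. A Turing ideal is a nonempty set $I$ of Turing degrees closed under joins and downward closed under $\le_T$; it is a Scott ideal if for every $\mathbf{a}\in I$ there is $\mathbf{b}\in I$ that is PA relative to $\mathbf{a}$. $G_I=\{g\in G:\deg(g)\in I\}$, where $\deg(g)$ is the Turing degree of $g$ as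 a function $\mathbb{N}\to\mathbb{N}$.
   Formalization: Orbit independence is taken to mean that the restriction map sending g to the sequence of its restrictions to the orbits is an isomorphism of G onto the product of the H_k; with an arbitrary abstract isomorphism the statement fails. *)

theory Defs
  imports
    "HOL-Analysis.Function_Topology"
    "HOL-Algebra.Bij"
    "HOL-Algebra.Product_Groups"
    "HOL-Library.Nat_Bijection"
    "HOL-Library.Sublist"
begin

section \<open>Turing degrees\<close>

text \<open>
  Partial functions \<open>\<nat> \<rightharpoonup> \<nat>\<close> that are \<open>\<mu>\<close>-recursive relative to a total function \<open>f\<close>.  Functions of
  several arguments are handled through the Cantor pairing \<^const>\<open>prod_encode\<close>, so unary functions
  suffice.
\<close>

definition pfun_pair :: "(nat \<rightharpoonup> nat) \<Rightarrow> (nat \<rightharpoonup> nat) \<Rightarrow> (nat \<rightharpoonup> nat)" where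
  "pfun_pair g h = (\<lambda>n. Option.bind (g n) (\<lambda>a. Option.bind (h n) (\<lambda>b. Some (prod_encode (a, b)))))"

definition pfun_prec :: "(nat \<rightharpoonup> nat) \<Rightarrow> (nat \<rightharpoonup> nat) \<Rightarrow> (nat \<rightharpoonup> nat)" where
  "pfun_prec g h = (\<lambda>n. case prod_decode n of (a, k) \<Rightarrow>
     rec_nat (g a) (\<lambda>y r. Option.bind r (\<lambda>i. h (prod_encode (a, prod_encode (y, i))))) k)"

definition pfun_mu :: "(nat \<rightharpoonup> nat) \<Rightarrow> (nat \<rightharpoonup> nat)" where
  "pfun_mu g = (\<lambda>a.
     if \<exists>n. g (prod_encode (a, n)) = Some 0 \<and> (\<forall>m<n. g (prod_encode (a, m)) \<noteq> None)
     then Some (LEAST n. g (prod_encode (a, n)) = Some 0) else None)"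

inductive partrec_in :: "(nat \<Rightarrow> nat) \<Rightarrow> (nat \<rightharpoonup> nat) \<Rightarrow> bool" for f :: "nat \<Rightarrow> nat" where
  query: "partrec_in f (\<lambda>n. Some (f n))"
| zero: "partrec_in f (\<lambda>n. Some 0)"
| succ: "partrec_in f (\<lambda>n. Some (Suc n))"
| left: "partrec_in f (\<lambda>n. Some (fst (prod_decode n)))"
| right: "partrec_in f (\<lambda>n. Some (snd (prod_decode n)))"
| pair: "partrec_in f g \<Longrightarrow> partrec_in f h \<Longrightarrow> partrec_in f (pfun_pair g h)"
| comp: "partrec_in f g \<Longrightarrow> partrec_in f h \<Longrightarrow> partrec_in f (g \<circ>\<^sub>m h)"
| prec: "partrec_in f g \<Longrightarrow> partrec_in f h \<Longrightarrow> partrec_in f (pfun_prec g h)"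
| mu: "partrec_in f g \<Longrightarrow> partrec_in f (pfun_mu g)"

definition turing_le :: "(nat \<Rightarrow> nat) \<Rightarrow> (nat \<Rightarrow> nat) \<Rightarrow> bool" (infix "\<le>\<^sub>T" 50) where
  "g \<le>\<^sub>T f \<longleftrightarrow> partrec_in f (\<lambda>n. Some (g n))"

definition turing_equiv :: "(nat \<Rightarrow> nat) \<Rightarrow> (nat \<Rightarrow> nat) \<Rightarrow> bool" where
  "turing_equiv f g \<longleftrightarrow> f \<le>\<^sub>T g \<and> g \<le>\<^sub>T f"

definition turing_join :: "(nat \<Rightarrow> nat) \<Rightarrow> (nat \<Rightarrow> nat) \<Rightarrow> (nat \<Rightarrow> nat)" where
  "turing_join f g = (\<lambda>n. if even n then f (n div 2) else g (n div 2))"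

lemma partrec_in_trans: "partrec_in f h \<Longrightarrow> f \<le>\<^sub>T g \<Longrightarrow> partrec_in g h"
  by (induction rule: partrec_in.induct) (auto simp: turing_le_def intro: partrec_in.intros)

lemma turing_le_refl: "f \<le>\<^sub>T f"
  by (simp add: turing_le_def partrec_in.query)

lemma turing_le_trans: "f \<le>\<^sub>T g \<Longrightarrow> g \<le>\<^sub>T h \<Longrightarrow> f \<le>\<^sub>T h"
  using partrec_in_trans turing_le_def by blast

lemma turing_le_zero: "(\<lambda>n. 0) \<le>\<^sub>T f"
  and turing_le_succ: "Suc \<le>\<^sub>T f"
  and turing_le_left: "(\<lambda>n. fst (prod_decode n)) \<le>\<^sub>T f"
  and turing_le_right: "(\<lambda>n. snd (prod_decode n)) \<le>\<^sub>T f"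
  by (simp_all add: turing_le_def partrec_in.intros)

lemma turing_le_comp: "g \<le>\<^sub>T f \<Longrightarrow> h \<le>\<^sub>T f \<Longrightarrow> (\<lambda>n. g (h n)) \<le>\<^sub>T f"
  unfolding turing_le_def by (drule (1) partrec_in.comp) (simp add: map_comp_def)

lemma turing_le_Suc: "h \<le>\<^sub>T f \<Longrightarrow> (\<lambda>n. Suc (h n)) \<le>\<^sub>T f"
  by (rule turing_le_comp[OF turing_le_succ])

lemma turing_le_pair: "g \<le>\<^sub>T f \<Longrightarrow> h \<le>\<^sub>T f \<Longrightarrow> (\<lambda>n. prod_encode (g n, h n)) \<le>\<^sub>T f"
  unfolding turing_le_def by (drule (1) partrec_in.pair) (simp add: pfun_pair_def)

lemma turing_le_id: "(\<lambda>n. n) \<le>\<^sub>T f"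
  using turing_le_pair[OF turing_le_left turing_le_right] by simp

lemma turing_le_rec:
  assumes z: "z \<le>\<^sub>T f" and s: "s \<le>\<^sub>T f" and k: "k \<le>\<^sub>T f"
  shows "(\<lambda>n. rec_nat (z n) (\<lambda>y i. s (prod_encode (n, prod_encode (y, i)))) (k n)) \<le>\<^sub>T f"
proof -
  let ?r = "\<lambda>n. rec_nat (z (fst (prod_decode n)))
      (\<lambda>y i. s (prod_encode (fst (prod_decode n), prod_encode (y, i)))) (snd (prod_decode n))"
  have *: "rec_nat (Some (z a)) (\<lambda>y r. Option.bind r (\<lambda>i. Some (s (prod_encode (a, prod_encode (y, i)))))) m
      = Some (rec_nat (z a) (\<lambda>y i. s (prod_encode (a, prod_encode (y, i)))) m)" for a m
    by (induction m) auto
  have "pfun_prec (\<lambda>n. Some (z n)) (\<lambda>n. Some (s n)) = (\<lambda>n. Some (?r n))"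
    by (simp add: pfun_prec_def fun_eq_iff split_beta *)
  then have "?r \<le>\<^sub>T f"
    using z s partrec_in.prec unfolding turing_le_def by metis
  from turing_le_comp[OF this turing_le_pair[OF turing_le_id k]] show ?thesis
    by simp
qed

lemma turing_le_step:
  assumes "s \<le>\<^sub>T f"
  shows "(\<lambda>n. s (fst (prod_decode n))) \<le>\<^sub>T f"
    and "(\<lambda>n. s (fst (prod_decode (snd (prod_decode n))))) \<le>\<^sub>T f"
    and "(\<lambda>n. s (snd (prod_decode (snd (prod_decode n))))) \<le>\<^sub>T f"
  by (intro turing_le_comp[OF assms] turing_le_left turing_le_comp[OF turing_le_left]
      turing_le_comp[OF turing_le_right] turing_le_right)+

lemma turing_le_if:
  assumes "c \<le>\<^sub>T f" "g \<le>\<^sub>T f" "h \<le>\<^sub>T f"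
  shows "(\<lambda>n. if c n = 0 then g n else h n) \<le>\<^sub>T f"
proof -
  have "rec_nat x (\<lambda>_ _. y) m = (if m = 0 then x else y)" for x y :: nat and m :: nat
    by (cases m) auto
  then show ?thesis
    using turing_le_rec[OF assms(2) turing_le_step(1)[OF assms(3)] assms(1)] by simp
qed

lemma turing_le_double: "(\<lambda>n. 2 * n) \<le>\<^sub>T f"
proof -
  have "rec_nat 0 (\<lambda>y i. Suc (Suc i)) n = 2 * n" for n :: nat
    by (induction n) auto
  then show ?thesis
    using turing_le_rec[OF turing_le_zero turing_le_step(3)[OF turing_le_Suc[OF turing_le_succ]]
        turing_le_id, of f] by simp
qed

lemma turing_le_mod2: "(\<lambda>n. n mod 2) \<le>\<^sub>T f"
proof -
  have "(\<lambda>n. if n = 0 then 1 else 0) \<le>\<^sub>T f"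
    using turing_le_if[OF turing_le_id turing_le_Suc[OF turing_le_zero] turing_le_zero, of f] by (simp cong: if_cong)
  from turing_le_rec[OF turing_le_zero turing_le_step(3)[OF this] turing_le_id]
  have "(\<lambda>n. rec_nat 0 (\<lambda>y i. if i = 0 then 1 else 0) n) \<le>\<^sub>T f"
    by simp
  moreover have "rec_nat 0 (\<lambda>y i. if i = 0 then 1 else 0) n = n mod 2" for n :: nat
    by (induction n) (auto simp: mod_Suc)
  ultimately show ?thesis by simp
qed

lemma turing_le_div2: "(\<lambda>n. n div 2) \<le>\<^sub>T f"
proof -
  let ?s = "\<lambda>n. if fst (prod_decode (snd (prod_decode n))) mod 2 = 0
      then snd (prod_decode (snd (prod_decode n))) else Suc (snd (prod_decode (snd (prod_decode n))))"
  have "?s \<le>\<^sub>T f"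
    by (intro turing_le_if turing_le_step turing_le_mod2 turing_le_id turing_le_Suc)
  from turing_le_rec[OF turing_le_zero this turing_le_id]
  have "(\<lambda>n. rec_nat 0 (\<lambda>y i. if y mod 2 = 0 then i else Suc i) n) \<le>\<^sub>T f"
    by (simp cong: if_cong)
  moreover have "rec_nat 0 (\<lambda>y i. if y mod 2 = 0 then i else Suc i) n = n div 2" for n :: nat
    by (induction n) (auto, presburger+)
  ultimately show ?thesis by simp
qed

lemma turing_le_join1: "f \<le>\<^sub>T turing_join f g"
  using turing_le_comp[OF turing_le_refl turing_le_double, of "turing_join f g"]
  by (simp add: turing_join_def)

lemma turing_le_join2: "g \<le>\<^sub>T turing_join f g"
  using turing_le_comp[OF turing_le_refl turing_le_Suc[OF turing_le_double], of "turing_join f g"]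
  by (simp add: turing_join_def)

lemma turing_join_least:
  assumes "f \<le>\<^sub>T h" "g \<le>\<^sub>T h"
  shows "turing_join f g \<le>\<^sub>T h"
  using turing_le_if[OF turing_le_mod2 turing_le_comp[OF assms(1) turing_le_div2]
      turing_le_comp[OF assms(2) turing_le_div2]]
  by (simp add: turing_join_def even_iff_mod_2_eq_zero)

quotient_type turing_degree = "nat \<Rightarrow> nat" / turing_equiv
  morphisms rep_degree deg
  by (auto intro!: equivpI reflpI sympI transpI simp: turing_equiv_def turing_le_refl
      intro: turing_le_trans)

instantiation turing_degree :: semilattice_sup
begin

lift_definition less_eq_turing_degree :: "turing_degree \<Rightarrow> turing_degree \<Rightarrow> bool" is turing_le
  unfolding turing_equiv_def by (blast intro: turing_le_trans)

definition less_turing_degree :: "turing_degree \<Rightarrow> turing_degree \<Rightarrow> bool" where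
  "less_turing_degree a b \<longleftrightarrow> a \<le> b \<and> \<not> b \<le> a"

lift_definition sup_turing_degree :: "turing_degree \<Rightarrow> turing_degree \<Rightarrow> turing_degree" is turing_join
  unfolding turing_equiv_def
  by (blast intro: turing_join_least turing_le_trans turing_le_join1 turing_le_join2)

instance
proof
  fix a b c :: turing_degree
  show "a < b \<longleftrightarrow> a \<le> b \<and> \<not> b \<le> a" by (rule less_turing_degree_def)
  show "a \<le> a" by transfer (rule turing_le_refl)
  show "a \<le> b \<Longrightarrow> b \<le> c \<Longrightarrow> a \<le> c" by transfer (rule turing_le_trans)
  show "a \<le> b \<Longrightarrow> b \<le> a \<Longrightarrow> a = b" by transfer (simp add: turing_equiv_def)
  show "a \<le> sup a b" by transfer (rule turing_le_join1)
  show "b \<le> sup a b" by transfer (rule turing_le_join2)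
  show "b \<le> a \<Longrightarrow> c \<le> a \<Longrightarrow> sup b c \<le> a" by transfer (rule turing_join_least)
qed

end

definition deg_set :: "nat set \<Rightarrow> turing_degree" where
  "deg_set A = deg (\<lambda>n. of_bool (n \<in> A))"


section \<open>Scott ideals\<close>

definition binary_tree :: "nat list set \<Rightarrow> bool" where
  "binary_tree T \<longleftrightarrow> (\<forall>\<sigma>\<in>T. set \<sigma> \<subseteq> {0, 1}) \<and> (\<forall>\<tau>\<in>T. \<forall>\<sigma>. prefix \<sigma> \<tau> \<longrightarrow> \<sigma> \<in> T)"

definition tree_path :: "nat list set \<Rightarrow> (nat \<Rightarrow> nat) \<Rightarrow> bool" where
  "tree_path T p \<longleftrightarrow> (\<forall>n. map p [0..<n] \<in> T)"

text \<open>A degree \<open>b\<close> is PA relative to \<open>a\<close> if every infinite \<open>a\<close>-computable tree of binary strings has a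
  \<open>b\<close>-computable path.\<close>

definition PA_relative :: "turing_degree \<Rightarrow> turing_degree \<Rightarrow> bool" where
  "PA_relative b a \<longleftrightarrow>
     (\<forall>T. binary_tree T \<and> infinite T \<and> deg_set (list_encode ` T) \<le> a \<longrightarrow>
        (\<exists>p. tree_path T p \<and> deg p \<le> b))"

definition turing_ideal :: "turing_degree set \<Rightarrow> bool" where
  "turing_ideal I \<longleftrightarrow>
     I \<noteq> {} \<and> (\<forall>a\<in>I. \<forall>b\<in>I. sup a b \<in> I) \<and> (\<forall>a\<in>I. \<forall>b. b \<le> a \<longrightarrow> b \<in> I)"

definition scott_ideal :: "turing_degree set \<Rightarrow> bool" where
  "scott_ideal I \<longleftrightarrow> turing_ideal I \<and> (\<forall>a\<in>I. \<exists>b\<in>I. PA_relative b a)"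


section \<open>Profinite subgroups of the group of permutations of the natural numbers\<close>

abbreviation S_inf :: "(nat \<Rightarrow> nat) monoid" where
  "S_inf \<equiv> BijGroup UNIV"

definition orb :: "(nat \<Rightarrow> nat) set \<Rightarrow> nat \<Rightarrow> nat set" where
  "orb G n = {g n |g. g \<in> G}"

text \<open>The topology on \<^typ>\<open>nat \<Rightarrow> nat\<close> is the product of discrete topologies, i.e. pointwise
  convergence.\<close>

definition profinite_subgroup :: "(nat \<Rightarrow> nat) set \<Rightarrow> bool" where
  "profinite_subgroup G \<longleftrightarrow>
     subgroup G S_inf \<and> closedin (top_of_set (carrier S_inf)) G \<and> (\<forall>n. finite (orb G n))"

fun orbit_enum :: "(nat \<Rightarrow> nat) set \<Rightarrow> nat \<Rightarrow> nat set" where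
  "orbit_enum G 0 = orb G 0"
| "orbit_enum G (Suc n) = orb G (LEAST x. \<forall>m\<in>{..n}. x \<notin> orbit_enum G m)"

definition orbit_group :: "(nat \<Rightarrow> nat) set \<Rightarrow> nat \<Rightarrow> (nat \<Rightarrow> nat) monoid" where
  "orbit_group G k = (BijGroup (orbit_enum G k))
     \<lparr>carrier := {restrict g (orbit_enum G k) |g. g \<in> G}\<rparr>"

text \<open>
  Orbit independence asks that the canonical embedding \<open>g \<mapsto> (g \<restriction> O\<^sub>k)\<^sub>k\<close> of \<open>G\<close> into the product of
  the \<open>H\<^sub>k\<close> be an isomorphism, i.e. that the actions of \<open>G\<close> on its orbits can be prescribed
  independently.  The existence of some abstract isomorphism would be strictly weaker: a group may
  repeat an action on several orbits and still be isomorphic to the product.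
\<close>

definition orbit_independent :: "(nat \<Rightarrow> nat) set \<Rightarrow> bool" where
  "orbit_independent G \<longleftrightarrow>
     (\<lambda>g k. restrict g (orbit_enum G k)) \<in> iso (S_inf\<lparr>carrier := G\<rparr>) (product_group UNIV (orbit_group G))"


section \<open>The tree of a permutation group and its degree\<close>

definition perm_string :: "(nat \<Rightarrow> nat) \<Rightarrow> nat \<Rightarrow> nat list" where
  "perm_string g n = concat (map (\<lambda>i. [g i, inv_into UNIV g i]) [0..<Suc n])"

definition perm_tree :: "(nat \<Rightarrow> nat) set \<Rightarrow> nat list set" where
  "perm_tree G = {perm_string g n |g n. g \<in> G}"

text \<open>
  The strings in \<^const>\<open>perm_tree\<close> all have even length, so immediate successors are taken with
  respect to the prefix order on the tree itself rather than on all strings.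
\<close>

definition immediate_succs :: "nat list set \<Rightarrow> nat list \<Rightarrow> nat list set" where
  "immediate_succs T \<sigma> =
     {\<tau>\<in>T. strict_prefix \<sigma> \<tau> \<and> \<not> (\<exists>\<rho>\<in>T. strict_prefix \<sigma> \<rho> \<and> strict_prefix \<rho> \<tau>)}"

definition branching :: "nat list set \<Rightarrow> nat \<Rightarrow> nat" where
  "branching T c = (if list_decode c \<in> T then card (immediate_succs T (list_decode c)) else 0)"

definition deg_tree :: "nat list set \<Rightarrow> turing_degree" where
  "deg_tree T = sup (deg_set (list_encode ` T)) (deg (branching T))"

definition ideal_part :: "(nat \<Rightarrow> nat) set \<Rightarrow> turing_degree set \<Rightarrow> (nat \<Rightarrow> nat) set" where
  "ideal_part G I = {g\<in>G. deg g \<in> I}"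


section \<open>First-order logic of groups\<close>

datatype group_term =
    TVar nat
  | TOne
  | TInv group_term
  | TMult group_term group_term

datatype group_formula =
    FEq group_term group_term
  | FNot group_formula
  | FAnd group_formula group_formula
  | FEx nat group_formula

fun term_vars :: "group_term \<Rightarrow> nat set" where
  "term_vars (TVar x) = {x}"
| "term_vars TOne = {}"
| "term_vars (TInv s) = term_vars s"
| "term_vars (TMult s t) = term_vars s \<union> term_vars t"

fun free_vars :: "group_formula \<Rightarrow> nat set" where
  "free_vars (FEq s t) = term_vars s \<union> term_vars t"
| "free_vars (FNot \<phi>) = free_vars \<phi>"
| "free_vars (FAnd \<phi> \<psi>) = free_vars \<phi> \<union> free_vars \<psi>"
| "free_vars (FEx x \<phi>) = free_vars \<phi> - {x}"

fun term_val :: "('a, 'b) monoid_scheme \<Rightarrow> (nat \<Rightarrow> 'a) \<Rightarrow> group_term \<Rightarrow> 'a" where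
  "term_val M v (TVar x) = v x"
| "term_val M v TOne = \<one>\<^bsub>M\<^esub>"
| "term_val M v (TInv s) = inv\<^bsub>M\<^esub> (term_val M v s)"
| "term_val M v (TMult s t) = term_val M v s \<otimes>\<^bsub>M\<^esub> term_val M v t"

fun satisfies :: "('a, 'b) monoid_scheme \<Rightarrow> (nat \<Rightarrow> 'a) \<Rightarrow> group_formula \<Rightarrow> bool" where
  "satisfies M v (FEq s t) \<longleftrightarrow> term_val M v s = term_val M v t"
| "satisfies M v (FNot \<phi>) \<longleftrightarrow> \<not> satisfies M v \<phi>"
| "satisfies M v (FAnd \<phi> \<psi>) \<longleftrightarrow> satisfies M v \<phi> \<and> satisfies M v \<psi>"
| "satisfies M v (FEx x \<phi>) \<longleftrightarrow> (\<exists>a\<in>carrier M. satisfies M (v(x := a)) \<phi>)"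

definition elementary_subgroup :: "'a set \<Rightarrow> ('a, 'b) monoid_scheme \<Rightarrow> bool" where
  "elementary_subgroup A M \<longleftrightarrow>
     subgroup A M \<and>
     (\<forall>\<phi> v. (\<forall>x\<in>free_vars \<phi>. v x \<in> A) \<longrightarrow>
        satisfies (M\<lparr>carrier := A\<rparr>) v \<phi> = satisfies M v \<phi>)"

end

theory Submission
  imports Defs
begin

text \<open>
  A group with independent finite orbits is the full product of its finite actions on the orbits.
  In the style of Feferman and Vaught, whether a formula holds of a tuple in such a product is
  decided by a colouring of the orbits with finitely many colours, where the colour of an orbit
  depends only on the action of the tuple there, and by the number of orbits of each colour,
  counted up to a threshold \<open>N\<close>.  The branching function bounds the nodes of every level of the tree,
  so the finite actions, and with them all these colourings, are computable from the tree.

  Given a witness \<open>b\<close> for an existential formula over a tuple \<open>a\<close>, let a new witness copy \<open>b\<close> on finitely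
  many orbits that contain all orbits of rare colours and \<open>N\<close> orbits of each other colour, and let it
  take on any other orbit the first value that produces a frequent colour.  The new witness yields
  the same truncated counts and is computable from \<open>a\<close> and the tree, so the Tarski-Vaught test applies.
\<close>

section \<open>Relative computability\<close>

named_theorems turing_intros

abbreviation turing_le2 :: "(nat \<Rightarrow> nat \<Rightarrow> nat) \<Rightarrow> (nat \<Rightarrow> nat) \<Rightarrow> bool" where
  "turing_le2 h f \<equiv> (\<lambda>p. h (fst (prod_decode p)) (snd (prod_decode p))) \<le>\<^sub>T f"

definition turing_dec :: "(nat \<Rightarrow> bool) \<Rightarrow> (nat \<Rightarrow> nat) \<Rightarrow> bool" where
  "turing_dec P f \<longleftrightarrow> (\<lambda>n. of_bool (P n)) \<le>\<^sub>T f"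

abbreviation turing_dec2 :: "(nat \<Rightarrow> nat \<Rightarrow> bool) \<Rightarrow> (nat \<Rightarrow> nat) \<Rightarrow> bool" where
  "turing_dec2 P f \<equiv> turing_dec (\<lambda>p. P (fst (prod_decode p)) (snd (prod_decode p))) f"

declare turing_le_id [turing_intros] turing_le_Suc [turing_intros]

lemma turing_le_comp2:
  assumes "turing_le2 h f" "a \<le>\<^sub>T f" "b \<le>\<^sub>T f"
  shows "(\<lambda>n. h (a n) (b n)) \<le>\<^sub>T f"
  using turing_le_comp[OF assms(1) turing_le_pair[OF assms(2,3)]] by simp

lemma turing_le_fst [turing_intros]: "h \<le>\<^sub>T f \<Longrightarrow> (\<lambda>n. fst (prod_decode (h n))) \<le>\<^sub>T f"
  by (rule turing_le_comp[OF turing_le_left])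

lemma turing_le_snd [turing_intros]: "h \<le>\<^sub>T f \<Longrightarrow> (\<lambda>n. snd (prod_decode (h n))) \<le>\<^sub>T f"
  by (rule turing_le_comp[OF turing_le_right])

lemma turing_le_const [turing_intros]: "(\<lambda>n. c) \<le>\<^sub>T f"
  by (induction c) (auto intro: turing_le_zero turing_le_Suc)

text \<open>Restates \<open>turing_le_rec\<close> with a curried step function, so that it can be
  matched directly against a \<open>rec_nat\<close> term.\<close>

lemma turing_le_rec_nat:
  assumes "z \<le>\<^sub>T f" "k \<le>\<^sub>T f"
    and "(\<lambda>p. s (fst (prod_decode p)) (fst (prod_decode (snd (prod_decode p))))
           (snd (prod_decode (snd (prod_decode p))))) \<le>\<^sub>T f"
  shows "(\<lambda>n. rec_nat (z n) (s n) (k n)) \<le>\<^sub>T f"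
  using turing_le_rec[OF assms(1,3,2)] by simp

lemma turing_le_add [turing_intros]:
  assumes "g \<le>\<^sub>T f" "h \<le>\<^sub>T f" shows "(\<lambda>n. g n + h n) \<le>\<^sub>T f"
proof -
  have "rec_nat a (\<lambda>y i. Suc i) b = a + b" for a b by (induction b) auto
  moreover have "(\<lambda>n. rec_nat (g n) (\<lambda>y i. Suc i) (h n)) \<le>\<^sub>T f"
    by (intro turing_le_rec_nat turing_intros assms)
  ultimately show ?thesis by simp
qed

lemma turing_le_mult [turing_intros]:
  assumes "g \<le>\<^sub>T f" "h \<le>\<^sub>T f" shows "(\<lambda>n. g n * h n) \<le>\<^sub>T f"
proof -
  have "rec_nat 0 (\<lambda>y i. i + a) b = a * b" for a b :: nat by (induction b) auto
  moreover have "(\<lambda>n. rec_nat 0 (\<lambda>y i. i + g n) (h n)) \<le>\<^sub>T f"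
    by (intro turing_le_rec_nat turing_intros assms(2) turing_le_comp[OF assms(1)])
  ultimately show ?thesis by simp
qed

lemma turing_le_diff [turing_intros]:
  assumes "g \<le>\<^sub>T f" "h \<le>\<^sub>T f" shows "(\<lambda>n. g n - h n) \<le>\<^sub>T f"
proof -
  \<comment> \<open>The predecessor: the recursion discards its previous value and returns the
    index, with 0 at 0.\<close>
  have "rec_nat 0 (\<lambda>y i. y) b = b - 1" for b :: nat by (cases b) auto
  moreover have "(\<lambda>n. rec_nat 0 (\<lambda>y i. y) n) \<le>\<^sub>T f"
    by (intro turing_le_rec_nat turing_intros)
  ultimately have pred: "(\<lambda>n. n - 1) \<le>\<^sub>T f" by simp
  have "rec_nat a (\<lambda>y i. i - 1) b = a - b" for a b :: nat by (induction b) auto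
  moreover have "(\<lambda>n. rec_nat (g n) (\<lambda>y i. i - 1) (h n)) \<le>\<^sub>T f"
    by (intro turing_le_rec_nat turing_intros assms turing_le_comp[OF pred])
  ultimately show ?thesis by simp
qed

lemma turing_le_sum [turing_intros]:
  assumes "k \<le>\<^sub>T f" "turing_le2 g f"
  shows "(\<lambda>n. \<Sum>i<k n. g n i) \<le>\<^sub>T f"
proof -
  have "rec_nat 0 (\<lambda>y i. i + a y) b = (\<Sum>i<b. a i)" for a :: "nat \<Rightarrow> nat" and b :: nat
    by (induction b) auto
  moreover have "(\<lambda>n. rec_nat 0 (\<lambda>y i. i + g n y) (k n)) \<le>\<^sub>T f"
    by (intro turing_le_rec_nat turing_intros assms turing_le_comp2[OF assms(2)])
  ultimately show ?thesis by simp
qed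

lemma of_bool_not_iff_nat: "of_bool (\<not> b) = 1 - (of_bool b :: nat)"
  by (cases b) auto

lemma turing_dec_not [turing_intros]: "turing_dec P f \<Longrightarrow> turing_dec (\<lambda>n. \<not> P n) f"
  unfolding turing_dec_def by (subst of_bool_not_iff_nat) (intro turing_intros)

lemma turing_dec_and [turing_intros]:
  "turing_dec P f \<Longrightarrow> turing_dec Q f \<Longrightarrow> turing_dec (\<lambda>n. P n \<and> Q n) f"
  unfolding turing_dec_def of_bool_conj by (intro turing_intros)

lemma turing_dec_imp [turing_intros]:
  "turing_dec P f \<Longrightarrow> turing_dec Q f \<Longrightarrow> turing_dec (\<lambda>n. P n \<longrightarrow> Q n) f"
  using turing_dec_not[OF turing_dec_and[OF _ turing_dec_not]] by simp

lemma turing_dec_or [turing_intros]: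
  "turing_dec P f \<Longrightarrow> turing_dec Q f \<Longrightarrow> turing_dec (\<lambda>n. P n \<or> Q n) f"
  using turing_dec_imp[OF turing_dec_not] by (simp add: disj_imp)

lemma turing_dec_const [turing_intros]: "turing_dec (\<lambda>n. b) f"
  unfolding turing_dec_def by (intro turing_intros)

lemma turing_le_of_bool [turing_intros]: "turing_dec P f \<Longrightarrow> (\<lambda>n. of_bool (P n)) \<le>\<^sub>T f"
  by (simp add: turing_dec_def)

lemma turing_dec_le [turing_intros]:
  assumes "g \<le>\<^sub>T f" "h \<le>\<^sub>T f" shows "turing_dec (\<lambda>n. g n \<le> h n) f"
proof -
  have "of_bool (g n \<le> h n) = 1 - (g n - h n)" for n by auto
  then show ?thesis unfolding turing_dec_def by (simp only:) (intro turing_intros assms)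
qed

lemma turing_dec_eq [turing_intros]:
  fixes g h :: "nat \<Rightarrow> nat"
  shows "g \<le>\<^sub>T f \<Longrightarrow> h \<le>\<^sub>T f \<Longrightarrow> turing_dec (\<lambda>n. g n = h n) f"
  unfolding eq_iff by (intro turing_intros)

text \<open>A bounded sum counts the counterexamples; the quantifier then becomes the test that this
  count is zero.\<close>

lemma turing_dec_ball [turing_intros]:
  assumes "k \<le>\<^sub>T f" "turing_dec2 P f"
  shows "turing_dec (\<lambda>n. \<forall>i<k n. P n i) f"
proof -
  have "(\<forall>i<k n. P n i) \<longleftrightarrow> (\<Sum>i<k n. of_bool (\<not> P n i)) = (0 :: nat)" for n
    by auto
  then show ?thesis by (simp only:) (intro turing_intros assms)
qed

lemma turing_dec_bex [turing_intros]:
  assumes "k \<le>\<^sub>T f" "turing_dec2 P f"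
  shows "turing_dec (\<lambda>n. \<exists>i<k n. P n i) f"
  using turing_dec_not[OF turing_dec_ball[OF assms(1) turing_dec_not[OF assms(2)]]] by simp

lemma turing_dec_finite:
  assumes "finite S" "h \<le>\<^sub>T f"
  shows "turing_dec (\<lambda>n. h n \<in> S) f"
  using assms(1) by (induction rule: finite_induct) (auto intro!: turing_intros assms(2))

lemma turing_le_If [turing_intros]:
  assumes "turing_dec P f" "g \<le>\<^sub>T f" "h \<le>\<^sub>T f"
  shows "(\<lambda>n. if P n then g n else h n) \<le>\<^sub>T f"
  using turing_le_if[OF turing_dec_not[OF assms(1), unfolded turing_dec_def] assms(2,3)]
  by simp

text \<open>Unbounded search. \<open>pfun_mu\<close> looks for a zero, so it is applied to the
  characteristic function of the negation; \<open>ex\<close> makes the search total.\<close>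

lemma turing_le_Least [turing_intros]:
  assumes "turing_dec2 P f" and ex: "\<And>n. \<exists>i. P n i"
  shows "(\<lambda>n. LEAST i. P n i) \<le>\<^sub>T f"
proof -
  let ?q = "\<lambda>p. Some (of_bool (\<not> P (fst (prod_decode p)) (snd (prod_decode p)))) :: nat option"
  have "partrec_in f (pfun_mu ?q)"
    using turing_dec_not[OF assms(1)] by (intro partrec_in.mu) (simp add: turing_dec_def turing_le_def)
  moreover have "pfun_mu ?q = (\<lambda>n. Some (LEAST i. P n i))"
    using ex by (auto simp: pfun_mu_def fun_eq_iff)
  ultimately show ?thesis by (simp add: turing_le_def)
qed

text \<open>The patch \<open>a\<close> may be any function at all: its finitely many relevant values
  are built in as constants, one at a time.\<close>

lemma turing_le_finite_patch:
  assumes "finite F" "h \<le>\<^sub>T f"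
  shows "(\<lambda>n. if n \<in> F then a n else h n) \<le>\<^sub>T f"
  using assms(1)
proof (induction rule: finite_induct)
  case empty
  then show ?case by (simp add: assms)
next
  case (insert m F)
  have "(\<lambda>n. if n = m then a m else if n \<in> F then a n else h n) \<le>\<^sub>T f"
    by (intro turing_intros insert.IH)
  also have "(\<lambda>n. if n = m then a m else if n \<in> F then a n else h n) =
      (\<lambda>n. if n \<in> insert m F then a n else h n)" by auto
  finally show ?case .
qed

text \<open>The preimage is found by searching, and surjectivity guarantees that the search
  stops.\<close>

lemma turing_le_inv:
  assumes "bij g" "g \<le>\<^sub>T f" shows "inv_into UNIV g \<le>\<^sub>T f"
proof -
  have "inv_into UNIV g n = (LEAST i. g i = n)" for n
    by (metis (mono_tags, lifting) LeastI assms(1) bij_inv_eq_iff)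
  moreover have "(\<lambda>n. LEAST i. g i = n) \<le>\<^sub>T f"
    using assms(1) by (intro turing_intros turing_le_comp[OF assms(2)]) (metis bij_inv_eq_iff)
  ultimately show ?thesis by presburger
qed

section \<open>Truncated cardinalities\<close>

definition trunc_card :: "nat \<Rightarrow> 'a set \<Rightarrow> nat" where
  "trunc_card N A = (if finite A then min N (card A) else N)"

lemma trunc_card_le: "trunc_card N A \<le> N"
  by (simp add: trunc_card_def)

lemma trunc_card_empty [simp]: "trunc_card N {} = 0"
  by (simp add: trunc_card_def)

lemma trunc_card_eq_0: "0 < N \<Longrightarrow> trunc_card N A = 0 \<longleftrightarrow> A = {}"
  by (auto simp: trunc_card_def min_def)

lemma trunc_card_mono: "A \<subseteq> B \<Longrightarrow> trunc_card N A \<le> trunc_card N B"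
  by (auto simp: trunc_card_def min_def dest: finite_subset card_mono)

lemma trunc_card_min: "M \<le> N \<Longrightarrow> trunc_card M A = min M (trunc_card N A)"
  by (auto simp: trunc_card_def)

lemma trunc_card_bij: "bij_betw f A B \<Longrightarrow> trunc_card N A = trunc_card N B"
  using bij_betw_finite[of f A B] bij_betw_same_card[of f A B] by (simp add: trunc_card_def)

lemma trunc_card_Un_disjoint:
  "A \<inter> B = {} \<Longrightarrow> trunc_card N (A \<union> B) = min N (trunc_card N A + trunc_card N B)"
  by (auto simp: trunc_card_def card_Un_disjoint)

text \<open>For disjoint sets the truncated count of a union is the truncated sum of the truncated
  counts, hence depends on these alone.\<close>

lemma trunc_card_UN_cong:
  assumes "finite S"
    and "\<And>s s'. s \<in> S \<Longrightarrow> s' \<in> S \<Longrightarrow> s \<noteq> s' \<Longrightarrow> A s \<inter> A s' = {}"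
    and "\<And>s s'. s \<in> S \<Longrightarrow> s' \<in> S \<Longrightarrow> s \<noteq> s' \<Longrightarrow> B s \<inter> B s' = {}"
    and "\<And>s. s \<in> S \<Longrightarrow> trunc_card N (A s) = trunc_card N (B s)"
  shows "trunc_card N (\<Union>s\<in>S. A s) = trunc_card N (\<Union>s\<in>S. B s)"
  using assms
proof (induction rule: finite_induct)
  case (insert x F)
  have "A x \<inter> (\<Union>s\<in>F. A s) = {}" "B x \<inter> (\<Union>s\<in>F. B s) = {}"
    using insert.hyps insert.prems(1,2) by blast+
  moreover have "trunc_card N (\<Union>s\<in>F. A s) = trunc_card N (\<Union>s\<in>F. B s)"
    using insert by simp
  ultimately show ?case
    using insert.prems(3)[of x] by (simp add: trunc_card_Un_disjoint)
qed simp

lemma trunc_card_subset: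
  obtains C where "C \<subseteq> A" "finite C" "card C = trunc_card N A"
proof (cases "finite A")
  case True
  then show ?thesis
    using obtain_subset_with_card_n[of "trunc_card N A" A] that
    by (metis min.cobounded2 trunc_card_def)
next
  case False
  then show ?thesis
    using infinite_arbitrarily_large[of A N] that by (auto simp: trunc_card_def)
qed

lemma trunc_card_subset_eq:
  assumes "trunc_card N A < N" "C \<subseteq> A" "finite C" "card C = trunc_card N A"
  shows "C = A"
  using assms by (auto simp: trunc_card_def min_def split: if_splits dest: card_subset_eq)

text \<open>Collect every element of a colour used fewer than \<open>N\<close> times and
  \<open>N\<close> elements of each other colour. This finite set records all truncated
  counts.\<close>

lemma colouring_sample:
  fixes \<kappa> :: "'a \<Rightarrow> nat"
  assumes "\<And>a. a \<in> A \<Longrightarrow> \<kappa> a < K"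
  obtains F where "F \<subseteq> A" "finite F" "card F \<le> N * K"
    and "\<forall>i. card {a \<in> F. \<kappa> a = i} = trunc_card N {a \<in> A. \<kappa> a = i}"
proof -
  have "\<exists>C. C \<subseteq> {a \<in> A. \<kappa> a = i} \<and> finite C \<and> card C = trunc_card N {a \<in> A. \<kappa> a = i}" for i
    by (rule trunc_card_subset[of "{a \<in> A. \<kappa> a = i}" N]) blast
  then obtain C where C: "\<And>i. C i \<subseteq> {a \<in> A. \<kappa> a = i}" "\<And>i. finite (C i)"
      "\<And>i. card (C i) = trunc_card N {a \<in> A. \<kappa> a = i}"
    by metis
  let ?F = "\<Union>i<K. C i"
  have "card ?F \<le> (\<Sum>i<K. card (C i))" by (rule card_UN_le) simp
  also have "\<dots> \<le> (\<Sum>i<K. N)" by (rule sum_mono) (simp add: C(3) trunc_card_le)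
  finally have "card ?F \<le> N * K" by (simp add: mult.commute)
  moreover have "{a \<in> ?F. \<kappa> a = i} = C i" for i
    using C(1) assms by blast
  ultimately show ?thesis
    using C by (intro that[of ?F]) auto
qed

text \<open>The slack \<open>N * K + 1\<close> guarantees a colour used more than \<open>N\<close> times, which absorbs all
  surplus elements of \<open>B\<close>.\<close>

lemma colouring_transfer:
  fixes \<kappa> :: "'a \<Rightarrow> nat" and B :: "'b set"
  assumes \<kappa>: "\<And>a. a \<in> A \<Longrightarrow> \<kappa> a < K"
    and AB: "trunc_card (N * K + 1) A = trunc_card (N * K + 1) B"
  obtains \<kappa>' where "\<kappa>' ` B \<subseteq> \<kappa> ` A"
    and "\<And>i. trunc_card N {a \<in> A. \<kappa> a = i} = trunc_card N {b \<in> B. \<kappa>' b = i}"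
proof (cases "trunc_card (N * K + 1) A < N * K + 1")
  case True
  then have "finite A" "finite B" "card A = card B"
    using AB by (auto simp: trunc_card_def min_def split: if_splits)
  \<comment> \<open>Below the threshold counts are exact, so a bijection carries the colouring over
    unchanged.\<close>
  then obtain f where f: "bij_betw f B A"
    by (metis finite_same_card_bij)
  have "bij_betw f {b \<in> B. \<kappa> (f b) = i} {a \<in> A. \<kappa> a = i}" for i
    using f by (auto simp: bij_betw_def inj_on_def)
  then have "trunc_card N {a \<in> A. \<kappa> a = i} = trunc_card N {b \<in> B. \<kappa> (f b) = i}" for i
    by (metis trunc_card_bij)
  then show ?thesis
    using that[of "\<lambda>b. \<kappa> (f b)"] f by (auto simp: bij_betw_def)
next
  case False
  have bigA: "finite A \<Longrightarrow> N * K < card A" and bigB: "finite B \<Longrightarrow> N * K < card B"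
    using False AB by (auto simp: trunc_card_def min_def split: if_splits)
  \<comment> \<open>Pigeonhole: \<open>K\<close> classes of at most \<open>N\<close> elements each
    would leave at most \<open>N * K\<close> elements in \<open>A\<close>.\<close>
  have "\<exists>i0. \<not> (finite {a \<in> A. \<kappa> a = i0} \<and> card {a \<in> A. \<kappa> a = i0} \<le> N)"
  proof (rule ccontr)
    assume "\<not> ?thesis"
    then have *: "finite {a \<in> A. \<kappa> a = i}" "card {a \<in> A. \<kappa> a = i} \<le> N" for i by auto
    have A: "A = (\<Union>i<K. {a \<in> A. \<kappa> a = i})" using \<kappa> by auto
    then have "finite A" using * by (metis (no_types, lifting) finite_UN finite_lessThan)
    have "card A \<le> (\<Sum>i<K. card {a \<in> A. \<kappa> a = i})"
      by (subst A) (rule card_UN_le, simp)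
    also have "\<dots> \<le> (\<Sum>i<K. N)" by (rule sum_mono) (rule *)
    finally show False using bigA[OF \<open>finite A\<close>] by (simp add: mult.commute)
  qed
  then obtain i0 where i0: "\<not> (finite {a \<in> A. \<kappa> a = i0} \<and> card {a \<in> A. \<kappa> a = i0} \<le> N)" ..
  then have "{a \<in> A. \<kappa> a = i0} \<noteq> {}" by (metis card.empty finite.emptyI le0)
  then have i0A: "i0 \<in> \<kappa> ` A" by blast
  have i0N: "trunc_card N {a \<in> A. \<kappa> a = i0} = N"
    using i0 by (auto simp: trunc_card_def)
  obtain F where F: "F \<subseteq> A" "finite F" "card F \<le> N * K"
      "\<forall>i. card {a \<in> F. \<kappa> a = i} = trunc_card N {a \<in> A. \<kappa> a = i}"
    by (rule colouring_sample[where N = N, OF \<kappa>])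
  \<comment> \<open>\<open>B\<close> is infinite or has more than \<open>N * K\<close> elements, so
    it has room for a copy of the sample \<open>F\<close>.\<close>
  have "\<exists>B0\<subseteq>B. finite B0 \<and> card B0 = card F"
    using bigB F(3) obtain_subset_with_card_n[of "card F" B] infinite_arbitrarily_large[of B "card F"]
    by (metis le_trans less_imp_le)
  then obtain B0 f where B0: "B0 \<subseteq> B" "finite B0" and f: "bij_betw f B0 F"
    using F(2) by (metis finite_same_card_bij)
  define \<kappa>' where "\<kappa>' b = (if b \<in> B0 then \<kappa> (f b) else i0)" for b
  have fB0: "f b \<in> F" if "b \<in> B0" for b using f that by (auto simp: bij_betw_def)
  have bij: "bij_betw f {b \<in> B0. \<kappa> (f b) = i} {a \<in> F. \<kappa> a = i}" for i
    using f by (auto simp: bij_betw_def inj_on_def)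
  have card_B0: "card {b \<in> B0. \<kappa> (f b) = i} = trunc_card N {a \<in> A. \<kappa> a = i}" for i
    using F(4) bij_betw_same_card[OF bij[of i]] by simp
  have "trunc_card N {a \<in> A. \<kappa> a = i} = trunc_card N {b \<in> B. \<kappa>' b = i}" for i
  proof (cases "i = i0")
    case True
    have "trunc_card N {b \<in> B0. \<kappa> (f b) = i} \<le> trunc_card N {b \<in> B. \<kappa>' b = i}"
      using B0 by (intro trunc_card_mono) (auto simp: \<kappa>'_def)
    moreover have "trunc_card N {b \<in> B0. \<kappa> (f b) = i} = N"
      using B0 card_B0[of i] i0N True by (simp add: trunc_card_def)
    ultimately show ?thesis
      using i0N True trunc_card_le[of N "{b \<in> B. \<kappa>' b = i}"] by simp
  next
    case False
    then have "{b \<in> B. \<kappa>' b = i} = {b \<in> B0. \<kappa> (f b) = i}"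
      using B0 by (auto simp: \<kappa>'_def)
    then show ?thesis
      using B0 card_B0[of i] trunc_card_le[of N "{a \<in> A. \<kappa> a = i}"] by (simp add: trunc_card_def)
  qed
  moreover have "\<kappa>' ` B \<subseteq> \<kappa> ` A"
    using i0A fB0 F(1) by (auto simp: \<kappa>'_def)
  ultimately show ?thesis by (rule that[rotated])
qed

section \<open>Terms in permutation groups\<close>

text \<open>Interleaving a permutation with its inverse turns the strings of \<^const>\<open>perm_tree\<close> into initial
  segments of a function, and makes both directions available to an evaluation of terms that knows
  the function only through a finite string.\<close>

definition interleave :: "(nat \<Rightarrow> nat) \<Rightarrow> nat \<Rightarrow> nat" where
  "interleave g = turing_join g (inv_into UNIV g)"

lemma interleave_simps [simp]:
  "interleave g (2 * i) = g i" "interleave g (Suc (2 * i)) = inv_into UNIV g i"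
  by (auto simp: interleave_def turing_join_def)

text \<open>\<open>eval_bwd s\<close> evaluates the inverse of the term \<open>s\<close>: inversion
  exchanges the two functions, and products are read in the opposite order. The \<open>u x\<close>
  may be arbitrary functions, such as finite strings continued by zeros.\<close>

fun eval_fwd :: "group_term \<Rightarrow> (nat \<Rightarrow> nat \<Rightarrow> nat) \<Rightarrow> nat \<Rightarrow> nat"
  and eval_bwd :: "group_term \<Rightarrow> (nat \<Rightarrow> nat \<Rightarrow> nat) \<Rightarrow> nat \<Rightarrow> nat" where
  "eval_fwd (TVar x) u i = u x (2 * i)"
| "eval_fwd TOne u i = i"
| "eval_fwd (TInv s) u i = eval_bwd s u i"
| "eval_fwd (TMult s t) u i = eval_fwd s u (eval_fwd t u i)"
| "eval_bwd (TVar x) u i = u x (Suc (2 * i))"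
| "eval_bwd TOne u i = i"
| "eval_bwd (TInv s) u i = eval_fwd s u i"
| "eval_bwd (TMult s t) u i = eval_bwd t u (eval_bwd s u i)"

lemma turing_le_eval:
  assumes "\<And>x. turing_le2 (h x) f"
  shows "a \<le>\<^sub>T f \<Longrightarrow> (\<lambda>n. eval_fwd s (\<lambda>x. h x n) (a n)) \<le>\<^sub>T f"
    and "a \<le>\<^sub>T f \<Longrightarrow> (\<lambda>n. eval_bwd s (\<lambda>x. h x n) (a n)) \<le>\<^sub>T f"
  by (induction s arbitrary: a) (auto intro!: turing_intros turing_le_comp2[OF assms])

section \<open>Group operations and term values in \<open>S_inf\<close>\<close>

lemma carrier_S_inf: "carrier S_inf = {g. bij g}"
  by (simp add: BijGroup_def Bij_def extensional_def)

lemma mult_S_inf: "bij g \<Longrightarrow> bij h \<Longrightarrow> g \<otimes>\<^bsub>S_inf\<^esub> h = g \<circ> h"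
  by (simp add: BijGroup_def Bij_def extensional_def compose_def fun_eq_iff)

lemma one_S_inf: "\<one>\<^bsub>S_inf\<^esub> = id"
  by (simp add: BijGroup_def fun_eq_iff)

lemma inv_S_inf: "bij g \<Longrightarrow> inv\<^bsub>S_inf\<^esub> g = inv_into UNIV g"
  by (subst inv_BijGroup) (auto simp: Bij_def extensional_def)

lemma bij_term_val:
  "(\<And>x. x \<in> term_vars s \<Longrightarrow> bij (v x)) \<Longrightarrow> bij (term_val S_inf v s)"
  by (induction s) (auto simp: mult_S_inf inv_S_inf one_S_inf bij_imp_bij_inv intro: bij_comp)

text \<open>Both equations go through one induction because the case \<open>TInv\<close> uses each
  for the other.\<close>

lemma term_val_S_inf:
  assumes "\<And>x. x \<in> term_vars s \<Longrightarrow> bij (v x)"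
  shows "term_val S_inf v s = eval_fwd s (\<lambda>x. interleave (v x)) \<and>
    inv_into UNIV (term_val S_inf v s) = eval_bwd s (\<lambda>x. interleave (v x))"
  using assms
proof (induction s)
  case (TMult s t)
  let ?u = "\<lambda>x. interleave (v x)"
  have bij: "bij (term_val S_inf v s)" "bij (term_val S_inf v t)"
    using TMult.prems by (auto intro: bij_term_val)
  then have "term_val S_inf v (TMult s t) = term_val S_inf v s \<circ> term_val S_inf v t"
    by (simp add: mult_S_inf)
  moreover from this have "inv_into UNIV (term_val S_inf v (TMult s t))
      = inv_into UNIV (term_val S_inf v t) \<circ> inv_into UNIV (term_val S_inf v s)"
    using bij by (simp only: o_inv_distrib)
  moreover have "eval_fwd (TMult s t) ?u = eval_fwd s ?u \<circ> eval_fwd t ?u"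
    "eval_bwd (TMult s t) ?u = eval_bwd t ?u \<circ> eval_bwd s ?u"
    by (simp_all add: fun_eq_iff)
  ultimately show ?case
    using TMult by (metis UnCI term_vars.simps(4))
next
  case (TInv s)
  have "bij (term_val S_inf v s)"
    using TInv.prems by (auto intro: bij_term_val)
  then have "term_val S_inf v (TInv s) = inv_into UNIV (term_val S_inf v s)"
    "inv_into UNIV (inv_into UNIV (term_val S_inf v s)) = term_val S_inf v s"
    by (simp_all add: inv_S_inf inv_inv_eq)
  moreover have "eval_fwd (TInv s) u = eval_bwd s u" "eval_bwd (TInv s) u = eval_fwd s u" for u
    by (simp_all add: fun_eq_iff)
  ultimately show ?case
    using TInv by (metis term_vars.simps(3))
qed (auto simp: one_S_inf fun_eq_iff)

lemma term_val_subgroup: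
  assumes "subgroup A S_inf" "\<And>x. x \<in> term_vars s \<Longrightarrow> v x \<in> A"
  shows "term_val (S_inf\<lparr>carrier := A\<rparr>) v s = term_val S_inf v s \<and> term_val S_inf v s \<in> A"
  using assms(2)
  by (induction s)
    (auto simp: group.m_inv_consistent[OF group_BijGroup assms(1)] assms(1)
      intro: subgroup.m_closed subgroup.m_inv_closed subgroup.one_closed)

lemma finite_term_vars: "finite (term_vars s)"
  by (induction s) auto

lemma finite_free_vars: "finite (free_vars \<phi>)"
  by (induction \<phi>) (auto simp: finite_term_vars)

lemma term_val_cong:
  "(\<And>x. x \<in> term_vars s \<Longrightarrow> v x = w x) \<Longrightarrow> term_val M v s = term_val M w s"
  by (induction s) auto

lemma satisfies_cong:
  "(\<And>x. x \<in> free_vars \<phi> \<Longrightarrow> v x = w x) \<Longrightarrow> satisfies M v \<phi> = satisfies M w \<phi>"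
proof (induction \<phi> arbitrary: v w)
  case (FEq s t)
  then show ?case using term_val_cong[of s v w M] term_val_cong[of t v w M] by simp
next
  case (FNot \<phi>)
  then show ?case by (metis free_vars.simps(2) satisfies.simps(2))
next
  case (FAnd \<phi> \<psi>)
  have "satisfies M v \<phi> = satisfies M w \<phi>" "satisfies M v \<psi> = satisfies M w \<psi>"
    using FAnd.prems by (auto intro!: FAnd.IH)
  then show ?case by simp
next
  case (FEx x \<phi>)
  have "satisfies M (v(x := a)) \<phi> = satisfies M (w(x := a)) \<phi>" for a
    using FEx.prems by (intro FEx.IH) auto
  then show ?case by simp
qed

section \<open>Groups with independent finite orbits\<close>

lemma orbit_enum_orb: "\<exists>y. orbit_enum G k = orb G y"
  by (cases k) auto

text \<open>After stage \<open>n\<close> all numbers up to \<open>n\<close> are covered: if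
  \<open>Suc n\<close> is still missing then, it is the least missing number and its orbit comes
  next.\<close>

lemma orbit_enum_covers:
  assumes "\<And>n. n \<in> orb G n"
  shows "\<exists>k. i \<in> orbit_enum G k"
proof -
  have "\<forall>x\<le>n. \<exists>m\<le>n. x \<in> orbit_enum G m" for n
  proof (induction n)
    case 0
    then show ?case using assms by auto
  next
    case (Suc n)
    show ?case
    proof (cases "\<exists>m\<le>n. Suc n \<in> orbit_enum G m")
      case True
      then show ?thesis using Suc by (metis le_Suc_eq)
    next
      case False
      have "(LEAST x. \<forall>m\<in>{..n}. x \<notin> orbit_enum G m) = Suc n"
      proof (rule Least_equality)
        show "\<forall>m\<in>{..n}. Suc n \<notin> orbit_enum G m" using False by simp
        show "Suc n \<le> y" if "\<forall>m\<in>{..n}. y \<notin> orbit_enum G m" for y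
          using that Suc by (metis atMost_iff not_less_eq_eq)
      qed
      then have "Suc n \<in> orbit_enum G (Suc n)" using assms by simp
      then show ?thesis using Suc by (metis le_Suc_eq order_refl)
    qed
  qed
  then show ?thesis by blast
qed

locale independent_orbits =
  fixes G :: "(nat \<Rightarrow> nat) set"
  assumes subgroup_G: "subgroup G S_inf"
    and finite_orb: "\<And>n. finite (orb G n)"
    and orbit_independent_G: "orbit_independent G"
begin

lemma bij_G: "g \<in> G \<Longrightarrow> bij g"
  using subgroup.subset[OF subgroup_G] by (auto simp: carrier_S_inf)

lemma id_G: "id \<in> G"
  using subgroup.one_closed[OF subgroup_G] by (simp add: one_S_inf)

lemma comp_G: "g \<in> G \<Longrightarrow> h \<in> G \<Longrightarrow> g \<circ> h \<in> G"
  using subgroup.m_closed[OF subgroup_G, of g h] by (simp add: mult_S_inf bij_G)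

lemma inv_G: "g \<in> G \<Longrightarrow> inv_into UNIV g \<in> G"
  using subgroup.m_inv_closed[OF subgroup_G, of g] by (simp add: inv_S_inf bij_G)

lemma orb_refl: "n \<in> orb G n"
  using id_G by (auto simp: orb_def intro!: exI[of _ id])

lemma orb_image:
  assumes "g \<in> G" "i \<in> orb G j" shows "g i \<in> orb G j"
proof -
  obtain h where "h \<in> G" "i = h j" using assms(2) by (auto simp: orb_def)
  then show ?thesis using comp_G[OF assms(1)] by (auto simp: orb_def intro!: exI[of _ "g \<circ> h"])
qed

lemma orb_sym:
  assumes "i \<in> orb G j" shows "j \<in> orb G i"
proof -
  obtain g where "g \<in> G" "i = g j" using assms by (auto simp: orb_def)
  then show ?thesis
    using inv_G[of g] bij_G[of g] by (auto simp: orb_def bij_is_inj intro!: exI[of _ "inv_into UNIV g"])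
qed

lemma orb_eq:
  assumes "i \<in> orb G j" shows "orb G i = orb G j"
proof -
  have "orb G i \<subseteq> orb G j" if "i \<in> orb G j" for i j
    using orb_image that by (auto simp: orb_def[of G i])
  then show ?thesis using assms orb_sym by blast
qed

text \<open>Orbits are named by their least elements instead of their indices in
  \<open>orbit_enum\<close>; the name of the orbit of a given point is then found by a direct
  search.\<close>

definition orb_rep :: "nat \<Rightarrow> nat" where
  "orb_rep i = (LEAST j. j \<in> orb G i)"

definition reps :: "nat set" where
  "reps = range orb_rep"

lemma orb_rep_in: "orb_rep i \<in> orb G i"
  unfolding orb_rep_def by (rule LeastI, rule orb_refl)

lemma orb_rep_eq: "i \<in> orb G j \<Longrightarrow> orb_rep i = orb_rep j"
  by (simp add: orb_rep_def orb_eq)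

lemma orb_rep_reps: "j \<in> reps \<Longrightarrow> i \<in> orb G j \<Longrightarrow> orb_rep i = j"
  using orb_rep_eq orb_rep_in by (metis rangeE reps_def)

lemma in_orb_rep: "i \<in> orb G (orb_rep i)"
  using orb_sym orb_rep_in by blast

text \<open>This is the surjectivity of the canonical embedding of \<open>G\<close> into the product
  of its actions on the orbits.\<close>

lemma glue:
  assumes "\<And>j. gs j \<in> G"
  obtains g where "g \<in> G" "\<And>i. g i = gs (orb_rep i) i"
proof -
  \<comment> \<open>Translates the index \<open>k\<close> of an orbit into its
    representative.\<close>
  let ?m = "\<lambda>k. LEAST j. j \<in> orbit_enum G k"
  let ?h = "\<lambda>k. restrict (gs (?m k)) (orbit_enum G k)"
  have "?h \<in> carrier (product_group UNIV (orbit_group G))"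
    using assms by (auto simp: orbit_group_def)
  also have "\<dots> = (\<lambda>g k. restrict g (orbit_enum G k)) ` G"
    using orbit_independent_G by (auto simp: orbit_independent_def iso_def bij_betw_def)
  finally obtain g where g: "g \<in> G" "\<And>k. restrict g (orbit_enum G k) = ?h k"
    by (force simp: fun_eq_iff)
  show ?thesis
  proof
    show "g \<in> G" by fact
    fix i
    obtain k where k: "i \<in> orbit_enum G k" using orbit_enum_covers orb_refl by blast
    then have "orbit_enum G k = orb G i"
      using orbit_enum_orb[of G k] orb_eq by blast
    then have "?m k = orb_rep i" by (simp add: orb_rep_def)
    then show "g i = gs (orb_rep i) i"
      using g(2)[of k] k by (metis restrict_apply')
  qed
qed

end

section \<open>Computing with codes of strings\<close>

text \<open>Subtracting 1 undoes the successor in the code of a nonempty list. The code 0 of the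
  empty list is a fixed point, so dropping too much is harmless and \<open>entry\<close> is 0 past
  the end.\<close>

definition drop_code :: "nat \<Rightarrow> nat \<Rightarrow> nat" where
  "drop_code i e = rec_nat e (\<lambda>_ c. snd (prod_decode (c - 1))) i"

definition entry :: "nat \<Rightarrow> nat \<Rightarrow> nat" where
  "entry e i = fst (prod_decode (drop_code i e - 1))"

lemma prod_decode_0: "prod_decode 0 = (0, 0)"
  using prod_encode_inverse[of "(0, 0)"] by (simp add: prod_encode_def)

lemma drop_code_list_encode: "drop_code i (list_encode xs) = list_encode (drop i xs)"
proof -
  have *: "snd (prod_decode (list_encode ys - Suc 0)) = list_encode (tl ys)" for ys
    by (cases ys) (auto simp: prod_decode_0)
  show ?thesis
    by (induction i) (auto simp: drop_code_def * tl_drop drop_Suc)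
qed

lemma entry_list_encode: "i < length xs \<Longrightarrow> entry (list_encode xs) i = xs ! i"
  by (simp add: entry_def drop_code_list_encode Cons_nth_drop_Suc[symmetric])

text \<open>Decoding never increases a number; through this, bounds on codes of nodes become bounds
  on points of orbits.\<close>

lemma entry_le: "entry e i \<le> e"
proof -
  have fs: "fst (prod_decode n) \<le> n" "snd (prod_decode n) \<le> n" for n
    using le_prod_encode_1[of "fst (prod_decode n)" "snd (prod_decode n)"]
      le_prod_encode_2[of "snd (prod_decode n)" "fst (prod_decode n)"] by simp_all
  have "drop_code i e \<le> e"
    by (induction i) (auto simp: drop_code_def intro: order_trans[OF fs(2)])
  then show ?thesis
    unfolding entry_def using fs(1)[of "drop_code i e - 1"] by linarith
qed

lemma turing_le_drop_code [turing_intros]: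
  "a \<le>\<^sub>T f \<Longrightarrow> b \<le>\<^sub>T f \<Longrightarrow> (\<lambda>n. drop_code (a n) (b n)) \<le>\<^sub>T f"
  unfolding drop_code_def by (intro turing_le_rec_nat turing_intros)

lemma turing_le_entry [turing_intros]:
  "a \<le>\<^sub>T f \<Longrightarrow> b \<le>\<^sub>T f \<Longrightarrow> (\<lambda>n. entry (a n) (b n)) \<le>\<^sub>T f"
  unfolding entry_def by (intro turing_intros)

lemma length_list_decode_eq: "length (list_decode e) = (LEAST i. drop_code i e = 0)"
proof -
  have "drop_code i e = 0 \<longleftrightarrow> length (list_decode e) \<le> i" for i
    using drop_code_list_encode[of i "list_decode e"] list_encode_eq[of "drop i (list_decode e)" "[]"]
    by simp
  then show ?thesis by (auto intro: Least_equality[symmetric])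
qed

lemma turing_le_length [turing_intros]:
  assumes "a \<le>\<^sub>T f" shows "(\<lambda>n. length (list_decode (a n))) \<le>\<^sub>T f"
proof -
  have "\<exists>i. drop_code i e = 0" for e
    using drop_code_list_encode[of "length (list_decode e)" "list_decode e"] by auto
  then have "(\<lambda>e. length (list_decode e)) \<le>\<^sub>T f"
    unfolding length_list_decode_eq by (intro turing_intros)
  from turing_le_comp[OF this assms] show ?thesis .
qed

section \<open>Strings and levels of the permutation tree\<close>

lemma perm_string_eq: "perm_string g n = map (interleave g) [0..<2 * n + 2]"
proof (induction n)
  case 0
  have "interleave g 0 = g 0" "interleave g (Suc 0) = inv_into UNIV g 0"
    using interleave_simps[of g 0] by simp_all
  then show ?case by (simp add: perm_string_def)
next
  case (Suc n)
  have "interleave g (2 + 2 * n) = g (Suc n)" "interleave g (3 + 2 * n) = inv_into UNIV g (Suc n)"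
    using interleave_simps[of g "Suc n"] by (simp_all add: numeral_eq_Suc)
  moreover have "perm_string g (Suc n) = perm_string g n @ [g (Suc n), inv_into UNIV g (Suc n)]"
    by (simp add: perm_string_def)
  ultimately show ?case
    using Suc by (simp add: numeral_eq_Suc)
qed

lemma length_perm_string [simp]: "length (perm_string g n) = 2 * n + 2"
  by (simp add: perm_string_eq)

lemma take_perm_string: "m \<le> n \<Longrightarrow> take (2 * m + 2) (perm_string g n) = perm_string g m"
  by (simp add: perm_string_eq take_map take_upt del: upt_Suc)

lemma entry_perm_string:
  "i < 2 * n + 2 \<Longrightarrow> entry (list_encode (perm_string g n)) i = interleave g i"
  by (subst entry_list_encode) (auto simp: perm_string_eq simp del: upt_Suc)

definition tree_oracle :: "nat list set \<Rightarrow> nat \<Rightarrow> nat" where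
  "tree_oracle T = turing_join (\<lambda>n. of_bool (n \<in> list_encode ` T)) (branching T)"

lemma deg_tree_oracle: "deg_tree T = deg (tree_oracle T)"
  by (simp add: deg_tree_def deg_set_def tree_oracle_def sup_turing_degree.abs_eq)

context independent_orbits
begin

definition node :: "nat \<Rightarrow> nat \<Rightarrow> bool" where
  "node n e \<longleftrightarrow> (\<exists>g\<in>G. e = list_encode (perm_string g n))"

text \<open>The length of a string in the tree determines its level, which makes levels decidable
  from the tree.\<close>

lemma node_iff:
  "node n e \<longleftrightarrow> e \<in> list_encode ` perm_tree G \<and> length (list_decode e) = 2 * n + 2"
  by (force simp: node_def perm_tree_def)

text \<open>The entries of a string of level \<open>n\<close> lie in the finite orbits of the
  numbers up to \<open>n\<close>.\<close>

lemma finite_nodes: "finite {e. node n e}"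
proof -
  let ?A = "\<Union>i\<le>n. orb G i"
  have "{e. node n e} \<subseteq> list_encode ` {xs. set xs \<subseteq> ?A \<and> length xs = 2 * n + 2}"
  proof
    fix e assume "e \<in> {e. node n e}"
    then obtain g where g: "g \<in> G" "e = list_encode (perm_string g n)" by (auto simp: node_def)
    have "set (perm_string g n) \<subseteq> ?A"
      using g(1) inv_G[OF g(1)] by (fastforce simp: perm_string_def orb_def)
    then show "e \<in> list_encode ` {xs. set xs \<subseteq> ?A \<and> length xs = 2 * n + 2}"
      using g by simp
  qed
  then show ?thesis
    by (rule finite_subset) (intro finite_imageI finite_lists_length_eq finite_UN_I finite_atMost finite_orb)
qed

text \<open>A proper extension within the tree passes through its own truncation to level
  \<open>Suc n\<close>, so immediate successors cannot be longer than that; comparing lengths shows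
  that nothing lies in between.\<close>

lemma immediate_succs_perm_string:
  assumes "g \<in> G"
  shows "immediate_succs (perm_tree G) (perm_string g n) =
    {perm_string h (Suc n) | h. h \<in> G \<and> perm_string h n = perm_string g n}"
proof (intro equalityI subsetI)
  fix \<tau> assume \<tau>: "\<tau> \<in> immediate_succs (perm_tree G) (perm_string g n)"
  from \<tau> obtain h k where h: "h \<in> G" "\<tau> = perm_string h k" "strict_prefix (perm_string g n) \<tau>"
    unfolding immediate_succs_def perm_tree_def by blast
  have no: "\<not> strict_prefix \<rho> \<tau>" if "\<rho> \<in> perm_tree G" "strict_prefix (perm_string g n) \<rho>" for \<rho>
    using \<tau> that by (auto simp: immediate_succs_def)
  have nk: "n < k" using prefix_length_less[OF h(3)] h(2) by simp
  then have eq: "perm_string g n = perm_string h n"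
    using h(2,3) take_perm_string[of n k h] by (metis length_perm_string less_imp_le prefix_order.less_imp_le take_is_prefix prefix_def append_eq_conv_conj)
  have take: "perm_string h n = take (2 * n + 2) (perm_string h (Suc n))"
    "perm_string h (Suc n) = take (2 * Suc n + 2) \<tau>"
    using nk h(2) by (simp_all only: take_perm_string Suc_leI le_SucI order_refl)
  have "strict_prefix (perm_string g n) (perm_string h (Suc n))"
    unfolding eq strict_prefix_def using take(1) take_is_prefix
    by (metis length_perm_string n_not_Suc_n add_right_cancel mult_cancel1 zero_neq_numeral)
  then have "\<not> strict_prefix (perm_string h (Suc n)) \<tau>"
    using no h(1) by (auto simp: perm_tree_def)
  then have "\<tau> = perm_string h (Suc n)"
    using take(2) take_is_prefix by (metis prefix_order.le_less)
  then show "\<tau> \<in> {perm_string h (Suc n) | h. h \<in> G \<and> perm_string h n = perm_string g n}"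
    using h(1) eq by auto
next
  fix \<tau> assume "\<tau> \<in> {perm_string h (Suc n) | h. h \<in> G \<and> perm_string h n = perm_string g n}"
  then obtain h where h: "h \<in> G" "\<tau> = perm_string h (Suc n)" "perm_string h n = perm_string g n"
    by blast
  have "prefix (perm_string g n) \<tau>"
    using take_perm_string[of n "Suc n" h] h take_is_prefix by (metis le_SucI order_refl)
  moreover have "length (perm_string g n) \<noteq> length \<tau>" using h(2) by simp
  ultimately have "strict_prefix (perm_string g n) \<tau>" unfolding strict_prefix_def by metis
  moreover have False
    if "\<rho> \<in> perm_tree G" "strict_prefix (perm_string g n) \<rho>" "strict_prefix \<rho> \<tau>" for \<rho>
    using that h(2) by (auto simp: perm_tree_def dest!: prefix_length_less)
  ultimately show "\<tau> \<in> immediate_succs (perm_tree G) (perm_string g n)"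
    using h by (auto simp: immediate_succs_def perm_tree_def)
qed

text \<open>Each node of level \<open>Suc n\<close> has exactly one truncation to level
  \<open>n\<close>, so the sets of immediate successors partition the next level.\<close>

lemma sum_branching: "(\<Sum>e | node n e. branching (perm_tree G) e) = card {e. node (Suc n) e}"
proof -
  let ?S = "\<lambda>e. list_encode ` immediate_succs (perm_tree G) (list_decode e)"
  have S: "?S (list_encode (perm_string g n)) =
      {list_encode (perm_string h (Suc n)) | h. h \<in> G \<and> perm_string h n = perm_string g n}"
    if "g \<in> G" for g
    using that by (auto simp: immediate_succs_perm_string)
  have "branching (perm_tree G) e = card (?S e)" if "node n e" for e
    using that by (auto simp: branching_def node_iff card_image inj_list_encode)
  then have "(\<Sum>e | node n e. branching (perm_tree G) e) = (\<Sum>e | node n e. card (?S e))"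
    by simp
  also have "\<dots> = card (\<Union>e\<in>{e. node n e}. ?S e)"
  proof (rule card_UN_disjoint[symmetric])
    show "finite {e. node n e}" by (rule finite_nodes)
    show "\<forall>e\<in>{e. node n e}. finite (?S e)"
    proof
      fix e assume "e \<in> {e. node n e}"
      then obtain g where "g \<in> G" "e = list_encode (perm_string g n)" by (auto simp: node_def)
      then have "?S e \<subseteq> {e. node (Suc n) e}" using S by (auto simp: node_def)
      then show "finite (?S e)" using finite_nodes finite_subset by blast
    qed
    have *: "perm_string h n = perm_string h' n" if "perm_string h (Suc n) = perm_string h' (Suc n)" for h h'
      using that take_perm_string[of n "Suc n"] by (metis le_SucI order_refl)
    show "\<forall>e\<in>{e. node n e}. \<forall>e'\<in>{e. node n e}. e \<noteq> e' \<longrightarrow> ?S e \<inter> ?S e' = {}"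
    proof (intro ballI impI, rule ccontr)
      fix e e' assume "e \<in> {e. node n e}" "e' \<in> {e. node n e}" and ne: "e \<noteq> e'"
        and int: "?S e \<inter> ?S e' \<noteq> {}"
      then obtain g g' where g: "g \<in> G" "e = list_encode (perm_string g n)"
          "g' \<in> G" "e' = list_encode (perm_string g' n)"
        by (auto simp: node_def)
      obtain x where "x \<in> ?S e" "x \<in> ?S e'" using int by blast
      then obtain h h' where "perm_string h n = perm_string g n" "perm_string h' n = perm_string g' n"
          "perm_string h (Suc n) = perm_string h' (Suc n)"
        unfolding g(2,4) S[OF g(1)] S[OF g(3)] using list_encode_eq by blast
      then show False using ne g * by metis
    qed
  qed
  also have "(\<Union>e\<in>{e. node n e}. ?S e) = (\<Union>g\<in>G. ?S (list_encode (perm_string g n)))"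
    by (auto simp: node_def)
  also have "\<dots> = {e. node (Suc n) e}"
    by (auto simp: S node_def simp del: list_encode_inverse)
  finally show ?thesis .
qed

section \<open>Computing the orbits from the tree\<close>

abbreviation tree_fn :: "nat \<Rightarrow> nat" where
  "tree_fn \<equiv> tree_oracle (perm_tree G)"

lemma turing_dec_node [turing_intros]:
  assumes "tree_fn \<le>\<^sub>T f" "a \<le>\<^sub>T f" "b \<le>\<^sub>T f"
  shows "turing_dec (\<lambda>n. node (a n) (b n)) f"
proof -
  have "(\<lambda>n. of_bool (n \<in> list_encode ` perm_tree G)) \<le>\<^sub>T f"
    using turing_le_trans[OF turing_le_join1] assms(1) by (auto simp: tree_oracle_def)
  from turing_le_comp[OF this assms(3)]
  have "turing_dec (\<lambda>n. b n \<in> list_encode ` perm_tree G) f"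
    by (simp add: turing_dec_def)
  then show ?thesis
    unfolding node_iff by (intro turing_intros assms)
qed

lemma turing_le_branching [turing_intros]:
  assumes "tree_fn \<le>\<^sub>T f" "a \<le>\<^sub>T f"
  shows "(\<lambda>n. branching (perm_tree G) (a n)) \<le>\<^sub>T f"
  using turing_le_trans[OF turing_le_join2] assms(1)
  by (intro turing_le_comp[OF _ assms(2)]) (auto simp: tree_oracle_def)

text \<open>The empty string is not in the tree, so no branching value counts the nodes of level 0.
  A bound for them enters the computation as a constant.\<close>

definition root_bound :: nat where
  "root_bound = (LEAST b. \<forall>e. node 0 e \<longrightarrow> e < b)"

lemma root_bound: "node 0 e \<Longrightarrow> e < root_bound"
proof -
  obtain b where "\<forall>e. node 0 e \<longrightarrow> e < b"
    using finite_nat_set_iff_bounded finite_nodes by (metis mem_Collect_eq)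
  then show "node 0 e \<Longrightarrow> e < root_bound"
    unfolding root_bound_def by (rule LeastI2) blast
qed

text \<open>A number \<open>b\<close> exceeds all nodes of level at most \<open>n\<close> as soon as the nodes below \<open>b\<close> account for
  the number of successors announced by the branching function.\<close>

definition complete_below :: "nat \<Rightarrow> nat \<Rightarrow> bool" where
  "complete_below n b \<longleftrightarrow> root_bound \<le> b \<and>
     (\<forall>m<n. (\<Sum>e<b. of_bool (node m e) * branching (perm_tree G) e)
           = (\<Sum>e<b. of_bool (node (Suc m) e)))"

definition node_bound :: "nat \<Rightarrow> nat" where
  "node_bound n = (LEAST b. complete_below n b)"

lemma sum_nodes:
  assumes "\<And>e. node m e \<Longrightarrow> e < b"
  shows "(\<Sum>e<b. of_bool (node m e) * h e) = (\<Sum>e | node m e. h e :: nat)"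
proof -
  have "(\<Sum>e<b. of_bool (node m e) * h e) = (\<Sum>e<b. if node m e then h e else 0)"
    by (intro sum.cong) auto
  also have "\<dots> = sum h {e \<in> {..<b}. node m e}"
    by (subst sum.inter_filter) auto
  also have "{e \<in> {..<b}. node m e} = {e. node m e}" using assms by auto
  finally show ?thesis .
qed

text \<open>Once \<open>b\<close> exceeds all nodes of the levels up to \<open>n\<close>, both sums
  are the full size of the next level. Hence the search for \<open>node_bound\<close> stops.\<close>

lemma complete_below_ex: "\<exists>b. complete_below n b"
proof -
  have "finite (\<Union>m\<le>n. {e. node m e})" using finite_nodes by blast
  then obtain b where b: "\<And>m e. m \<le> n \<Longrightarrow> node m e \<Longrightarrow> e < b"
    using finite_nat_set_iff_bounded by (metis (mono_tags, lifting) UN_iff atMost_iff mem_Collect_eq)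
  have "complete_below n (max b root_bound)"
    unfolding complete_below_def
  proof (intro conjI allI impI)
    fix m assume "m < n"
    then have "(\<Sum>e<max b root_bound. of_bool (node m e) * branching (perm_tree G) e)
        = card {e. node (Suc m) e}"
      using b[of m] by (subst sum_nodes) (auto simp: sum_branching less_max_iff_disj)
    moreover have "(\<Sum>e<max b root_bound. of_bool (node (Suc m) e) * 1) = card {e. node (Suc m) e}"
      using b[of "Suc m"] \<open>m < n\<close> by (subst sum_nodes) (auto simp: less_max_iff_disj)
    ultimately show "(\<Sum>e<max b root_bound. of_bool (node m e) * branching (perm_tree G) e)
        = (\<Sum>e<max b root_bound. of_bool (node (Suc m) e))" by simp
  qed simp
  then show ?thesis ..
qed

text \<open>Induction on the level: if level \<open>m\<close> lies below \<open>b\<close>, the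
  branching sum is the true size of level \<open>Suc m\<close>, so the equal number of nodes of that
  level found below \<open>b\<close> is all of them.\<close>

lemma complete_belowD:
  assumes "complete_below n b"
  shows "m \<le> n \<Longrightarrow> node m e \<Longrightarrow> e < b"
proof (induction m arbitrary: e)
  case 0
  then show ?case using assms root_bound by (force simp: complete_below_def)
next
  case (Suc m)
  then have "(\<Sum>e<b. of_bool (node m e) * branching (perm_tree G) e) = card {e. node (Suc m) e}"
    by (subst sum_nodes) (auto simp: sum_branching)
  then have "(\<Sum>e<b. of_bool (node (Suc m) e)) = card {e. node (Suc m) e}"
    using assms Suc.prems by (simp add: complete_below_def)
  moreover have "(\<Sum>e<b. of_bool (node (Suc m) e)) = card {e \<in> {..<b}. node (Suc m) e}"
    by (simp add: sum.inter_filter[symmetric] of_bool_def)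
  ultimately have "{e \<in> {..<b}. node (Suc m) e} = {e. node (Suc m) e}"
    by (intro card_subset_eq finite_nodes) auto
  then show ?case using Suc.prems by blast
qed

lemma node_bound: "node n e \<Longrightarrow> e < node_bound n"
  using complete_belowD LeastI_ex[OF complete_below_ex] unfolding node_bound_def by blast

lemma turing_le_node_bound [turing_intros]:
  assumes "tree_fn \<le>\<^sub>T f" "a \<le>\<^sub>T f"
  shows "(\<lambda>n. node_bound (a n)) \<le>\<^sub>T f"
proof -
  have "node_bound \<le>\<^sub>T f"
    unfolding node_bound_def complete_below_def
    by (intro turing_intros assms(1)) (use complete_below_ex in \<open>simp add: complete_below_def\<close>)
  then show ?thesis using assms(2) by (rule turing_le_comp)
qed

text \<open>A node of level \<open>j\<close> stores the image of \<open>j\<close> at position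
  \<open>2 * j\<close>, so a bounded search decides membership in an orbit.\<close>

lemma orb_iff: "i \<in> orb G j \<longleftrightarrow> (\<exists>e<node_bound j. node j e \<and> entry e (2 * j) = i)"
  using node_bound by (fastforce simp: orb_def node_def entry_perm_string)

lemma orb_less_node_bound: "i \<in> orb G j \<Longrightarrow> i < node_bound j"
  using entry_le le_less_trans unfolding orb_iff by blast

lemma turing_dec_orb [turing_intros]:
  assumes "tree_fn \<le>\<^sub>T f" "a \<le>\<^sub>T f" "b \<le>\<^sub>T f"
  shows "turing_dec (\<lambda>n. b n \<in> orb G (a n)) f"
  unfolding orb_iff
  by (intro turing_intros assms turing_le_comp[OF assms(2)] turing_le_comp[OF assms(3)])

lemma turing_le_orb_rep [turing_intros]:
  assumes "tree_fn \<le>\<^sub>T f" "a \<le>\<^sub>T f"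
  shows "(\<lambda>n. orb_rep (a n)) \<le>\<^sub>T f"
  unfolding orb_rep_def
  by (intro turing_intros assms turing_le_comp[OF assms(2)]) (use orb_refl in blast)

section \<open>Colourings of orbits\<close>

text \<open>Even and odd positions hold the two directions, as in \<open>interleave\<close>. Values
  that stay in the orbit keep the evaluation of terms there.\<close>

definition valid_on :: "nat \<Rightarrow> (nat \<Rightarrow> nat) \<Rightarrow> bool" where
  "valid_on j p \<longleftrightarrow> (\<forall>i\<in>orb G j. p (2 * i) \<in> orb G j \<and> p (Suc (2 * i)) \<in> orb G j)"

definition agree_on :: "nat \<Rightarrow> (nat \<Rightarrow> nat) \<Rightarrow> (nat \<Rightarrow> nat) \<Rightarrow> bool" where
  "agree_on j p q \<longleftrightarrow> (\<forall>i\<in>orb G j. p (2 * i) = q (2 * i) \<and> p (Suc (2 * i)) = q (Suc (2 * i)))"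

lemma agree_on_refl: "agree_on j p p"
  by (simp add: agree_on_def)

lemma valid_on_agree: "valid_on j p \<Longrightarrow> agree_on j p q \<Longrightarrow> valid_on j q"
  by (simp add: valid_on_def agree_on_def)

lemma valid_on_interleave: "g \<in> G \<Longrightarrow> valid_on j (interleave g)"
  by (simp add: valid_on_def orb_image inv_G)

text \<open>Agreement of the inverses comes for free: the preimage under \<open>g\<close> lies in
  the same orbit, where \<open>h\<close> acts as \<open>g\<close> does.\<close>

lemma agree_on_interleave:
  assumes "g \<in> G" "h \<in> G" "\<And>i. i \<in> orb G j \<Longrightarrow> g i = h i"
  shows "agree_on j (interleave g) (interleave h)"
proof -
  have "inv_into UNIV g i = inv_into UNIV h i" if "i \<in> orb G j" for i
  proof -
    have "inv_into UNIV g i \<in> orb G j" using that assms(1) by (simp add: orb_image inv_G)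
    then have "h (inv_into UNIV g i) = i"
      using assms(1) assms(3)[symmetric] bij_G by (simp add: bij_is_surj surj_f_inv_f)
    then show ?thesis using assms(2) bij_G by (metis bij_inv_eq_iff)
  qed
  then show ?thesis using assms(3) by (simp add: agree_on_def)
qed

text \<open>Nodes of level \<open>node_bound j\<close> describe an element of the group on the whole orbit of \<open>j\<close>.\<close>

definition local_node :: "nat \<Rightarrow> nat \<Rightarrow> bool" where
  "local_node j e \<longleftrightarrow> node (node_bound j) e"

definition local_code :: "(nat \<Rightarrow> nat) \<Rightarrow> nat \<Rightarrow> nat" where
  "local_code g j = list_encode (perm_string g (node_bound j))"

lemma local_node_iff: "local_node j e \<longleftrightarrow> (\<exists>g\<in>G. e = local_code g j)"
  by (simp add: local_node_def node_def local_code_def)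

lemma agree_on_local_code: "agree_on j (entry (local_code g j)) (interleave g)"
proof -
  have "2 * i < 2 * node_bound j + 2" "Suc (2 * i) < 2 * node_bound j + 2" if "i \<in> orb G j" for i
    using orb_less_node_bound[OF that] by simp_all
  then show ?thesis
    unfolding agree_on_def local_code_def by (metis entry_perm_string)
qed

text \<open>Intermediate values never leave the orbit, so only positions on which the two
  assignments agree are read.\<close>

lemma eval_local:
  assumes "\<And>x. valid_on j (u x)" "\<And>x. agree_on j (u x) (u' x)"
  shows "i \<in> orb G j \<Longrightarrow> eval_fwd s u i = eval_fwd s u' i \<and> eval_fwd s u i \<in> orb G j"
    and "i \<in> orb G j \<Longrightarrow> eval_bwd s u i = eval_bwd s u' i \<and> eval_bwd s u i \<in> orb G j"
proof (induction s arbitrary: i)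
  case (TVar x)
  {
    case 1
    then show ?case using assms[of x] by (simp add: valid_on_def agree_on_def)
  next
    case 2
    then show ?case using assms[of x] by (simp add: valid_on_def agree_on_def)
  }
next
  case (TInv s)
  {
    case 1
    then show ?case using TInv.IH(2) by (metis eval_fwd.simps(3))
  next
    case 2
    then show ?case using TInv.IH(1) by (metis eval_bwd.simps(3))
  }
next
  case (TMult s t)
  {
    case 1
    then show ?case using TMult.IH(1,3) by (metis eval_fwd.simps(4))
  next
    case 2
    then show ?case using TMult.IH(2,4) by (metis eval_bwd.simps(4))
  }
qed simp_all

text \<open>Computability is required along every computable family of assignments \<open>h\<close>, one variable at a
  time; so assignments need no codes.\<close>

definition colouring :: "(nat \<Rightarrow> (nat \<Rightarrow> nat \<Rightarrow> nat) \<Rightarrow> nat) \<Rightarrow> nat \<Rightarrow> bool" where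
  "colouring c K \<longleftrightarrow>
     (\<forall>j u. c j u < K) \<and>
     (\<forall>j u u'. (\<forall>x. valid_on j (u x)) \<longrightarrow> (\<forall>x. agree_on j (u x) (u' x)) \<longrightarrow> c j u = c j u') \<and>
     (\<forall>f a h. tree_fn \<le>\<^sub>T f \<longrightarrow> a \<le>\<^sub>T f \<longrightarrow> (\<forall>x. turing_le2 (h x) f) \<longrightarrow>
        (\<lambda>n. c (a n) (\<lambda>x. h x n)) \<le>\<^sub>T f)"

lemma colouring_less: "colouring c K \<Longrightarrow> c j u < K"
  by (simp add: colouring_def)

lemma colouring_cong:
  "colouring c K \<Longrightarrow> (\<And>x. valid_on j (u x)) \<Longrightarrow> (\<And>x. agree_on j (u x) (u' x)) \<Longrightarrow> c j u = c j u'"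
  by (simp add: colouring_def)

lemma colouring_turing_le:
  "colouring c K \<Longrightarrow> tree_fn \<le>\<^sub>T f \<Longrightarrow> a \<le>\<^sub>T f \<Longrightarrow> (\<And>x. turing_le2 (h x) f) \<Longrightarrow>
    (\<lambda>n. c (a n) (\<lambda>x. h x n)) \<le>\<^sub>T f"
  by (simp add: colouring_def)

text \<open>The bound on \<open>i\<close> makes the quantifier bounded and thus computable; it
  already covers the whole orbit. Colour 0 marks failure of the equation.\<close>

definition eq_colour :: "group_term \<Rightarrow> group_term \<Rightarrow> nat \<Rightarrow> (nat \<Rightarrow> nat \<Rightarrow> nat) \<Rightarrow> nat" where
  "eq_colour s t j u = of_bool (\<forall>i<node_bound j. i \<in> orb G j \<longrightarrow> eval_fwd s u i = eval_fwd t u i)"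

lemma eq_colour_iff: "eq_colour s t j u = of_bool (\<forall>i\<in>orb G j. eval_fwd s u i = eval_fwd t u i)"
  using orb_less_node_bound by (auto simp: eq_colour_def)

lemma colouring_eq: "colouring (eq_colour s t) 2"
  unfolding colouring_def
proof (intro conjI allI impI)
  fix j and u u' :: "nat \<Rightarrow> nat \<Rightarrow> nat" assume "\<forall>x. valid_on j (u x)" "\<forall>x. agree_on j (u x) (u' x)"
  then show "eq_colour s t j u = eq_colour s t j u'"
    using eval_local(1)[of j u u'] by (simp add: eq_colour_iff)
next
  fix f a and h :: "nat \<Rightarrow> nat \<Rightarrow> nat \<Rightarrow> nat" assume *: "tree_fn \<le>\<^sub>T f" "a \<le>\<^sub>T f" "\<forall>x. turing_le2 (h x) f"
  have "turing_le2 (\<lambda>p. h x (fst (prod_decode p))) f" for x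
    by (rule turing_le_comp2[OF spec[OF *(3)]]) (intro turing_intros)+
  from turing_le_eval(1)[of "\<lambda>x p. h x (fst (prod_decode p))", OF this turing_le_snd[OF turing_le_id]]
  have ev: "turing_le2 (\<lambda>n i. eval_fwd r (\<lambda>x. h x n) i) f" for r
    by simp
  show "(\<lambda>n. eq_colour s t (a n) (\<lambda>x. h x n)) \<le>\<^sub>T f"
    unfolding eq_colour_def
    by (intro turing_intros * turing_le_comp[OF *(2)] ev)
qed (simp add: eq_colour_def)

text \<open>The pair of colours is written in base \<open>K\<close>, so remainder and quotient
  recover its components.\<close>

lemma colouring_pair:
  assumes "colouring c K" "colouring d L"
  shows "colouring (\<lambda>j u. c j u + K * d j u) (K * L)"
  unfolding colouring_def
proof (intro conjI allI impI)
  fix j u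
  have "c j u < K" "Suc (d j u) \<le> L" using assms colouring_less by (auto simp: Suc_le_eq)
  then have "c j u + K * d j u < K * Suc (d j u)" "K * Suc (d j u) \<le> K * L"
    by (simp, intro mult_le_mono2)
  then show "c j u + K * d j u < K * L" by linarith
next
  fix j and u u' :: "nat \<Rightarrow> nat \<Rightarrow> nat" assume "\<forall>x. valid_on j (u x)" "\<forall>x. agree_on j (u x) (u' x)"
  then show "c j u + K * d j u = c j u' + K * d j u'"
    using colouring_cong[OF assms(1), of j u u'] colouring_cong[OF assms(2), of j u u'] by simp
next
  fix f a and h :: "nat \<Rightarrow> nat \<Rightarrow> nat \<Rightarrow> nat" assume "tree_fn \<le>\<^sub>T f" "a \<le>\<^sub>T f" "\<forall>x. turing_le2 (h x) f"
  then show "(\<lambda>n. c (a n) (\<lambda>x. h x n) + K * d (a n) (\<lambda>x. h x n)) \<le>\<^sub>T f"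
    using colouring_turing_le[OF assms(1), of f a h] colouring_turing_le[OF assms(2), of f a h]
    by (intro turing_le_add turing_le_mult turing_le_const) simp_all
qed

text \<open>The colours that a choice for \<open>x\<close> can produce on the orbit of
  \<open>j\<close>. The candidates have level \<open>node_bound j\<close>, so the iterated
  \<open>node_bound\<close> bounds their codes.\<close>

definition ex_colours ::
  "nat \<Rightarrow> (nat \<Rightarrow> (nat \<Rightarrow> nat \<Rightarrow> nat) \<Rightarrow> nat) \<Rightarrow> nat \<Rightarrow> nat \<Rightarrow> (nat \<Rightarrow> nat \<Rightarrow> nat) \<Rightarrow> nat set" where
  "ex_colours x c K j u =
     {i. i < K \<and> (\<exists>e<node_bound (node_bound j). local_node j e \<and> c j (u(x := entry e)) = i)}"

text \<open>A local string and the group element behind it agree on the orbit, so a colouring cannot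
  tell them apart.\<close>

lemma ex_colours_iff:
  assumes "colouring c K" "\<And>x. valid_on j (u x)"
  shows "i \<in> ex_colours x c K j u \<longleftrightarrow> (\<exists>g\<in>G. c j (u(x := interleave g)) = i)"
proof -
  have "c j (u(x := interleave g)) = c j (u(x := entry (local_code g j)))" if "g \<in> G" for g
    using assms(2) valid_on_interleave[OF that] agree_on_local_code[of j g]
    by (intro colouring_cong[OF assms(1)]) (auto simp: agree_on_def)
  then show ?thesis
    using node_bound colouring_less[OF assms(1)]
    by (auto simp: ex_colours_def local_node_iff local_node_def[symmetric]) (metis local_node_def local_node_iff)
qed

lemma turing_le_set_encode:
  assumes "\<And>i. turing_dec (\<lambda>n. P n i) f"
  shows "(\<lambda>n. set_encode {i. i < K \<and> P n i}) \<le>\<^sub>T f"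
proof -
  have "set_encode {i. i < K \<and> P n i} = (\<Sum>i<K. of_bool (P n i) * 2 ^ i)" for n
  proof -
    have "(\<Sum>i<K. of_bool (P n i) * 2 ^ i) = (\<Sum>i<K. if P n i then 2 ^ i else 0 :: nat)"
      by (intro sum.cong) auto
    also have "\<dots> = sum ((^) 2) {i \<in> {..<K}. P n i}"
      by (subst sum.inter_filter) auto
    finally show ?thesis by (simp add: set_encode_def)
  qed
  moreover have "(\<lambda>n. \<Sum>i<K. of_bool (P n i) * 2 ^ i) \<le>\<^sub>T f"
    by (induction K) (auto intro!: turing_intros assms)
  ultimately show ?thesis by simp
qed

lemma colouring_ex:
  assumes "colouring c K"
  shows "colouring (\<lambda>j u. set_encode (ex_colours x c K j u)) (2 ^ K)"
  unfolding colouring_def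
proof (intro conjI allI impI)
  fix j u
  have "set_encode (ex_colours x c K j u) \<le> (\<Sum>i<K. 2 ^ i)"
    unfolding set_encode_def ex_colours_def by (intro sum_mono2) auto
  also have "\<dots> < 2 ^ K" by (induction K) auto
  finally show "set_encode (ex_colours x c K j u) < 2 ^ K" .
next
  fix j and u u' :: "nat \<Rightarrow> nat \<Rightarrow> nat" assume *: "\<forall>x. valid_on j (u x)" "\<forall>x. agree_on j (u x) (u' x)"
  then have "\<forall>x. valid_on j (u' x)" using valid_on_agree by blast
  moreover have "c j (u(x := interleave g)) = c j (u'(x := interleave g))" if "g \<in> G" for g
    using * valid_on_interleave[OF that]
    by (intro colouring_cong[OF assms]) (auto simp: agree_on_refl)
  ultimately have "ex_colours x c K j u = ex_colours x c K j u'"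
    using * by (auto simp: ex_colours_iff[OF assms])
  then show "set_encode (ex_colours x c K j u) = set_encode (ex_colours x c K j u')" by simp
next
  fix f a and h :: "nat \<Rightarrow> nat \<Rightarrow> nat \<Rightarrow> nat" assume *: "tree_fn \<le>\<^sub>T f" "a \<le>\<^sub>T f" "\<forall>x. turing_le2 (h x) f"
  \<comment> \<open>The family of assignments is enlarged by a parameter for the string tried as the
    value of \<open>x\<close>.\<close>
  have h: "turing_le2 (\<lambda>p. ((\<lambda>y. h y (fst (prod_decode p)))(x := entry (snd (prod_decode p)))) y) f" for y
    by (cases "y = x") (auto intro!: turing_intros turing_le_comp2[OF spec[OF *(3)]])
  have c: "(\<lambda>p. c (a (fst (prod_decode p)))
      ((\<lambda>y. h y (fst (prod_decode p)))(x := entry (snd (prod_decode p))))) \<le>\<^sub>T f"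
    by (rule colouring_turing_le[OF assms *(1) _ h]) (intro turing_intros turing_le_comp[OF *(2)])
  show "(\<lambda>n. set_encode (ex_colours x c K (a n) (\<lambda>x. h x n))) \<le>\<^sub>T f"
    unfolding ex_colours_def local_node_def
    by (intro turing_le_set_encode turing_intros * turing_le_comp[OF *(2)] c)
qed

section \<open>Satisfaction is determined by truncated colour counts\<close>

abbreviation GG :: "(nat \<Rightarrow> nat) monoid" where
  "GG \<equiv> S_inf\<lparr>carrier := G\<rparr>"

definition colour_class ::
  "(nat \<Rightarrow> (nat \<Rightarrow> nat \<Rightarrow> nat) \<Rightarrow> nat) \<Rightarrow> (nat \<Rightarrow> nat \<Rightarrow> nat) \<Rightarrow> nat \<Rightarrow> nat set" where
  "colour_class c v i = {j \<in> reps. c j (\<lambda>x. interleave (v x)) = i}"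

definition similar ::
  "(nat \<Rightarrow> (nat \<Rightarrow> nat \<Rightarrow> nat) \<Rightarrow> nat) \<Rightarrow> nat \<Rightarrow> (nat \<Rightarrow> nat \<Rightarrow> nat) \<Rightarrow> (nat \<Rightarrow> nat \<Rightarrow> nat) \<Rightarrow> bool" where
  "similar c N v w \<longleftrightarrow> (\<forall>i. trunc_card N (colour_class c v i) = trunc_card N (colour_class c w i))"

lemma similar_sym: "similar c N v w \<Longrightarrow> similar c N w v"
  by (simp add: similar_def)

lemma similar_mono: "similar c N v w \<Longrightarrow> M \<le> N \<Longrightarrow> similar c M v w"
  unfolding similar_def by (simp add: trunc_card_min[of M N])

text \<open>Each class of the coarser colouring is a finite disjoint union of classes of the finer
  one.\<close>

lemma similar_coarsen:
  assumes "similar d N v w" "\<And>j u. c j u = p (d j u)" "\<And>j u. d j u < K"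
  shows "similar c N v w"
  unfolding similar_def
proof
  fix i
  have "colour_class c y i = (\<Union>s\<in>{s. s < K \<and> p s = i}. colour_class d y s)" for y
    using assms(2,3) by (auto simp: colour_class_def)
  then show "trunc_card N (colour_class c v i) = trunc_card N (colour_class c w i)"
    using assms(1) by (auto intro!: trunc_card_UN_cong simp: similar_def) (auto simp: colour_class_def)
qed

text \<open>One implication is enough, because \<open>similar\<close> is symmetric.\<close>

definition decides :: "(nat \<Rightarrow> (nat \<Rightarrow> nat \<Rightarrow> nat) \<Rightarrow> nat) \<Rightarrow> nat \<Rightarrow> group_formula \<Rightarrow> bool" where
  "decides c N \<phi> \<longleftrightarrow>
     (\<forall>v w. (\<forall>x. v x \<in> G) \<longrightarrow> (\<forall>x. w x \<in> G) \<longrightarrow> similar c N v w \<longrightarrow>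
        satisfies GG v \<phi> \<longrightarrow> satisfies GG w \<phi>)"

lemma decidesD:
  "decides c N \<phi> \<Longrightarrow> (\<And>x. v x \<in> G) \<Longrightarrow> (\<And>x. w x \<in> G) \<Longrightarrow> similar c N v w \<Longrightarrow>
    satisfies GG v \<phi> = satisfies GG w \<phi>"
  unfolding decides_def using similar_sym by blast

text \<open>Every number lies in the orbit of its representative, so an equation can be checked
  orbit by orbit.\<close>

lemma satisfies_FEq_iff:
  assumes "\<And>x. v x \<in> G"
  shows "satisfies GG v (FEq s t) \<longleftrightarrow> colour_class (eq_colour s t) v 0 = {}"
proof -
  let ?u = "\<lambda>x. interleave (v x)"
  have "term_val GG v r = eval_fwd r ?u" for r
    using term_val_subgroup[OF subgroup_G, of r v] term_val_S_inf[of r v] assms bij_G by simp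
  then have "satisfies GG v (FEq s t) \<longleftrightarrow> (\<forall>i. eval_fwd s ?u i = eval_fwd t ?u i)"
    by (simp add: fun_eq_iff)
  also have "\<dots> \<longleftrightarrow> (\<forall>j\<in>reps. \<forall>i\<in>orb G j. eval_fwd s ?u i = eval_fwd t ?u i)"
    using in_orb_rep unfolding reps_def by blast
  also have "\<dots> \<longleftrightarrow> colour_class (eq_colour s t) v 0 = {}"
    by (auto simp: colour_class_def eq_colour_iff)
  finally show ?thesis .
qed

lemma interleave_upd: "(\<lambda>y. interleave ((v(x := b)) y)) = (\<lambda>y. interleave (v y))(x := interleave b)"
  by auto

lemma colour_glue:
  assumes "colouring c K" "\<And>y. v y \<in> G" "g \<in> G" "h \<in> G" "\<And>i. i \<in> orb G j \<Longrightarrow> g i = h i"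
  shows "c j (\<lambda>y. interleave ((v(x := g)) y)) = c j (\<lambda>y. interleave ((v(x := h)) y))"
  using assms(2-)
  by (intro colouring_cong[OF assms(1)]) (auto simp: valid_on_interleave agree_on_refl agree_on_interleave)

text \<open>Back-and-forth step. Orbits are grouped by their set of attainable colours; within each
  group \<open>colouring_transfer\<close> moves the colour pattern of \<open>b\<close> to the side
  of \<open>w\<close>, and local elements realizing it are glued. The threshold is the one which
  that transfer requires.\<close>

lemma similar_extend:
  assumes c: "colouring c K" and v: "\<And>y. v y \<in> G" and w: "\<And>y. w y \<in> G"
    and sim: "similar (\<lambda>j u. set_encode (ex_colours x c K j u)) (N * K + 1) v w" and b: "b \<in> G"
  obtains b' where "b' \<in> G" "similar c N (v(x := b)) (w(x := b'))"
proof -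
  define c' where "c' j u = set_encode (ex_colours x c K j u)" for j u
  define \<kappa> where "\<kappa> j = c j (\<lambda>y. interleave ((v(x := b)) y))" for j
  have dec: "set_decode (c' j u) = ex_colours x c K j u" for j u
    unfolding c'_def by (intro set_encode_inverse) (auto simp: ex_colours_def)
  have c'_less: "c' j u < 2 ^ K" for j u
    using colouring_less[OF colouring_ex[OF c]] by (simp add: c'_def)
  define Q where "Q s \<kappa>' \<longleftrightarrow> \<kappa>' ` colour_class c' w s \<subseteq> \<kappa> ` colour_class c' v s \<and>
    (\<forall>i. trunc_card N {a \<in> colour_class c' v s. \<kappa> a = i} = trunc_card N {a \<in> colour_class c' w s. \<kappa>' a = i})"
    for s \<kappa>'
  have "\<exists>\<kappa>'. Q s \<kappa>'" for s
  proof -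
    have less: "\<kappa> a < K" for a using colouring_less[OF c] by (simp add: \<kappa>_def)
    have card: "trunc_card (N * K + 1) (colour_class c' v s) = trunc_card (N * K + 1) (colour_class c' w s)"
      using sim by (simp add: similar_def c'_def[abs_def])
    show ?thesis
      by (rule colouring_transfer[of "colour_class c' v s" \<kappa>, OF less card]) (auto simp: Q_def)
  qed
  then obtain \<kappa>' where \<kappa>': "\<And>s. Q s (\<kappa>' s)"
    by metis
  have \<kappa>'_img: "\<kappa>' s ` colour_class c' w s \<subseteq> \<kappa> ` colour_class c' v s"
    and \<kappa>'_card: "trunc_card N {a \<in> colour_class c' v s. \<kappa> a = i}
        = trunc_card N {a \<in> colour_class c' w s. \<kappa>' s a = i}" for s i
    using \<kappa>'[of s] by (simp_all add: Q_def)
  define s where "s j = c' j (\<lambda>y. interleave (w y))" for j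
  \<comment> \<open>The prescribed colour occurs under \<open>b\<close> at an orbit with the same
    attainable colours as \<open>j\<close>, so it is attainable at \<open>j\<close> as well.\<close>
  have ex: "\<exists>g\<in>G. c j (\<lambda>y. interleave ((w(x := g)) y)) = \<kappa>' (s j) j" if "j \<in> reps" for j
  proof -
    have "j \<in> colour_class c' w (s j)" using that by (simp add: colour_class_def s_def)
    then obtain a where a: "a \<in> colour_class c' v (s j)" "\<kappa>' (s j) j = \<kappa> a"
      using \<kappa>'_img by blast
    have "\<kappa> a \<in> ex_colours x c K a (\<lambda>y. interleave (v y))"
      unfolding \<kappa>_def interleave_upd
      by (subst ex_colours_iff[OF c]) (use b v valid_on_interleave in auto)
    also have "\<dots> = ex_colours x c K j (\<lambda>y. interleave (w y))"
      using a(1) by (simp add: colour_class_def s_def dec[symmetric])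
    finally show ?thesis
      unfolding interleave_upd a(2)
      by (subst (asm) ex_colours_iff[OF c]) (use w valid_on_interleave in auto)
  qed
  \<comment> \<open>The glued element only uses values at representatives; \<open>id\<close> fills
    the rest because \<open>glue\<close> takes a total family in \<open>G\<close>.\<close>
  define gs where "gs j = (if j \<in> reps then SOME g. g \<in> G \<and>
      c j (\<lambda>y. interleave ((w(x := g)) y)) = \<kappa>' (s j) j else id)" for j
  have gs: "gs j \<in> G \<and> c j (\<lambda>y. interleave ((w(x := gs j)) y)) = \<kappa>' (s j) j" if "j \<in> reps" for j
    using someI_ex[of "\<lambda>g. g \<in> G \<and> c j (\<lambda>y. interleave ((w(x := g)) y)) = \<kappa>' (s j) j"] ex[OF that] that
    unfolding gs_def by auto
  have gsG: "gs j \<in> G" for j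
    by (cases "j \<in> reps") (use gs in blast, simp add: gs_def id_G)
  obtain b' where b': "b' \<in> G" "\<And>i. b' i = gs (orb_rep i) i"
    using glue[of gs, OF gsG] by metis
  have col: "c j (\<lambda>y. interleave ((w(x := b')) y)) = \<kappa>' (s j) j" if "j \<in> reps" for j
    using colour_glue[where v = w and j = j and x = x, OF c w b'(1) gsG[of j]] gs[OF that] b'(2) orb_rep_reps[OF that] by simp
  have "similar c N (v(x := b)) (w(x := b'))"
    unfolding similar_def
  proof
    fix i
    have "colour_class c (v(x := b)) i = (\<Union>s<2 ^ K. {a \<in> colour_class c' v s. \<kappa> a = i})"
      using c'_less by (auto simp: colour_class_def \<kappa>_def)
    moreover have "colour_class c (w(x := b')) i = (\<Union>s<2 ^ K. {a \<in> colour_class c' w s. \<kappa>' s a = i})"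
      using c'_less col by (auto simp: colour_class_def s_def)
    moreover have "trunc_card N (\<Union>s<2 ^ K. {a \<in> colour_class c' v s. \<kappa> a = i})
        = trunc_card N (\<Union>s<2 ^ K. {a \<in> colour_class c' w s. \<kappa>' s a = i})"
      by (rule trunc_card_UN_cong) (auto simp: \<kappa>'_card, auto simp: colour_class_def)
    ultimately show "trunc_card N (colour_class c (v(x := b)) i) = trunc_card N (colour_class c (w(x := b')) i)"
      by simp
  qed
  with b'(1) show ?thesis by (rule that)
qed

text \<open>Feferman-Vaught analysis. An equation only asks whether some orbit has colour 0, so
  threshold 1 suffices; conjunction pairs the colourings and takes the larger threshold; a
  quantifier passes to sets of attainable colours and raises the threshold.\<close>

lemma decides_ex: "\<exists>c K N. colouring c K \<and> decides c N \<phi>"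
proof (induction \<phi>)
  case (FEq s t)
  have "decides (eq_colour s t) 1 (FEq s t)"
    unfolding decides_def
  proof (intro allI impI)
    fix v w :: "nat \<Rightarrow> nat \<Rightarrow> nat"
    assume *: "\<forall>x. v x \<in> G" "\<forall>x. w x \<in> G" "similar (eq_colour s t) 1 v w" "satisfies GG v (FEq s t)"
    then have "trunc_card 1 (colour_class (eq_colour s t) w 0) = 0"
      using satisfies_FEq_iff[of v s t] by (metis similar_def trunc_card_empty)
    then show "satisfies GG w (FEq s t)"
      using * satisfies_FEq_iff[of w s t] by (simp add: trunc_card_eq_0)
  qed
  then show ?case using colouring_eq by blast
next
  case (FNot \<phi>)
  then obtain c K N where c: "colouring c K" "decides c N \<phi>" by blast
  have "decides c N (FNot \<phi>)"
    using decidesD[OF c(2)] by (auto simp: decides_def)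
  then show ?case using c(1) by blast
next
  case (FAnd \<phi> \<psi>)
  then obtain c K N d L M where c: "colouring c K" "decides c N \<phi>" and d: "colouring d L" "decides d M \<psi>"
    by blast
  let ?e = "\<lambda>j u. c j u + K * d j u"
  note e = colouring_pair[OF c(1) d(1)]
  have "decides ?e (max N M) (FAnd \<phi> \<psi>)"
    unfolding decides_def
  proof (intro allI impI)
    fix v w :: "nat \<Rightarrow> nat \<Rightarrow> nat"
    assume *: "\<forall>x. v x \<in> G" "\<forall>x. w x \<in> G" "similar ?e (max N M) v w" "satisfies GG v (FAnd \<phi> \<psi>)"
    have "similar c (max N M) v w"
      by (rule similar_coarsen[OF *(3), where p = "\<lambda>s. s mod K" and K = "K * L"])
        (use colouring_less[OF c(1)] colouring_less[OF e] in auto)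
    moreover have "similar d (max N M) v w"
      by (rule similar_coarsen[OF *(3), where p = "\<lambda>s. s div K" and K = "K * L"])
        (use colouring_less[OF c(1)] colouring_less[OF e] in \<open>auto simp: div_add1_eq less_nat_zero_code\<close>)
    ultimately have "similar c N v w" "similar d M v w"
      by (auto intro: similar_mono)
    then show "satisfies GG w (FAnd \<phi> \<psi>)"
      using decidesD[OF c(2), of v w] decidesD[OF d(2), of v w] * by simp
  qed
  then show ?case using e by blast
next
  case (FEx x \<phi>)
  then obtain c K N where c: "colouring c K" "decides c N \<phi>" by blast
  let ?c = "\<lambda>j u. set_encode (ex_colours x c K j u)"
  have "decides ?c (N * K + 1) (FEx x \<phi>)"
    unfolding decides_def
  proof (intro allI impI)
    fix v w :: "nat \<Rightarrow> nat \<Rightarrow> nat"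
    assume *: "\<forall>x. v x \<in> G" "\<forall>x. w x \<in> G" "similar ?c (N * K + 1) v w" "satisfies GG v (FEx x \<phi>)"
    then obtain b where b: "b \<in> G" "satisfies GG (v(x := b)) \<phi>" by auto
    obtain b' where b': "b' \<in> G" "similar c N (v(x := b)) (w(x := b'))"
      using * b by (auto intro: similar_extend[OF c(1) _ _ *(3)])
    then have "satisfies GG (w(x := b')) \<phi>"
      using decidesD[OF c(2), of "v(x := b)" "w(x := b')"] * b by simp
    then show "satisfies GG w (FEx x \<phi>)" using b'(1) by auto
  qed
  then show ?case using colouring_ex[OF c(1)] by blast
qed

section \<open>Computable witnesses\<close>

text \<open>The given \<open>b\<close> need not be computable: it enters the new witness only
  through finitely many strings, while all other local choices are found by search relative to
  \<open>f\<close>.\<close>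

lemma computable_witness:
  assumes f: "tree_fn \<le>\<^sub>T f" and v: "\<And>y. v y \<in> G" and vf: "\<And>y. v y \<le>\<^sub>T f"
    and b: "b \<in> G" "satisfies GG (v(x := b)) \<phi>"
  obtains b' where "b' \<in> G" "b' \<le>\<^sub>T f" "satisfies GG (v(x := b')) \<phi>"
proof -
  obtain c K N where c: "colouring c K" "decides c N \<phi>" using decides_ex by blast
  define \<kappa> where "\<kappa> g j = c j (\<lambda>y. interleave ((v(x := g)) y))" for g j
  have \<kappa>_less: "\<kappa> g j < K" for g j using colouring_less[OF c(1)] by (simp add: \<kappa>_def)
  have \<kappa>_entry: "c j ((\<lambda>y. interleave (v y))(x := entry (local_code g j))) = \<kappa> g j" if "g \<in> G" for g j
    unfolding \<kappa>_def interleave_upd using v valid_on_interleave[OF that, of j] agree_on_local_code[of j g]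
    by (intro colouring_cong[OF c(1), symmetric]) (auto simp: agree_on_def valid_on_interleave)
  \<comment> \<open>Colours occurring at least \<open>N\<close> times under \<open>b\<close> may be used freely outside a finite set \<open>F0\<close> on
    which the new witness copies \<open>b\<close>.\<close>
  define S where "S = {i. i < K \<and> trunc_card N {j \<in> reps. \<kappa> b j = i} = N}"
  obtain F0 where F0: "F0 \<subseteq> reps" "finite F0" "card F0 \<le> N * K"
      "\<forall>i. card {a \<in> F0. \<kappa> b a = i} = trunc_card N {j \<in> reps. \<kappa> b j = i}"
    by (rule colouring_sample[where N = N, OF \<kappa>_less])
  \<comment> \<open>A colour outside \<open>S\<close> has an exact count below \<open>N\<close>, so
    the sample contains its whole class.\<close>
  have small: "j \<in> F0" if "j \<in> reps" "\<kappa> b j \<notin> S" for j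
  proof -
    have "trunc_card N {a \<in> reps. \<kappa> b a = \<kappa> b j} < N"
      using that(2) \<kappa>_less trunc_card_le[of N "{a \<in> reps. \<kappa> b a = \<kappa> b j}"] by (auto simp: S_def)
    then have "{a \<in> F0. \<kappa> b a = \<kappa> b j} = {a \<in> reps. \<kappa> b a = \<kappa> b j}"
      using F0 by (intro trunc_card_subset_eq) auto
    then show ?thesis using that(1) by blast
  qed
  define P where "P j e \<longleftrightarrow> local_node j e \<and> c j ((\<lambda>y. interleave (v y))(x := entry e)) \<in> S" for j e
  \<comment> \<open>The second disjunct stops the search at every number \<open>j\<close>, as
    totality requires, even where no suitable string exists.\<close>
  define E where "E j = (if j \<in> F0 then local_code b j
      else LEAST e. P j e \<or> node_bound (node_bound j) \<le> e)" for j
  have "interleave (v y) \<le>\<^sub>T f" for y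
    unfolding interleave_def by (intro turing_join_least vf turing_le_inv bij_G v)
  note iv = turing_le_comp[OF this]
  have h: "turing_le2 (\<lambda>p. ((\<lambda>y. interleave (v y))(x := entry (snd (prod_decode p)))) y) f" for y
    by (cases "y = x") (auto intro!: turing_intros iv)
  have "(\<lambda>p. c (fst (prod_decode p)) ((\<lambda>y. interleave (v y))(x := entry (snd (prod_decode p))))) \<le>\<^sub>T f"
    by (rule colouring_turing_le[OF c(1) f _ h]) (intro turing_intros)
  moreover have "finite S" by (simp add: S_def)
  ultimately have "turing_dec2 P f"
    unfolding P_def local_node_def by (intro turing_intros f turing_dec_finite)
  then have Ef: "E \<le>\<^sub>T f"
    unfolding E_def by (intro turing_le_finite_patch F0(2) turing_intros f) auto
  have E_node: "\<exists>g\<in>G. E j = local_code g j \<and> (j \<in> F0 \<longrightarrow> g = b) \<and> (j \<notin> F0 \<longrightarrow> \<kappa> g j \<in> S)"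
    if "j \<in> reps" for j
  proof (cases "j \<in> F0")
    case True
    then show ?thesis using b(1) by (auto simp: E_def)
  next
    case False
    let ?Q = "\<lambda>e. P j e \<or> node_bound (node_bound j) \<le> e"
    have ln: "local_node j (local_code b j)" using b(1) local_node_iff by blast
    have "\<kappa> b j \<in> S" using small that False by blast
    \<comment> \<open>The string of \<open>b\<close> itself is a candidate below the bound, so the
      search ends at a genuine candidate and not at the stopping value.\<close>
    then have "P j (local_code b j)" using \<kappa>_entry[OF b(1)] ln by (simp add: P_def)
    then have "?Q (LEAST e. ?Q e)" "(LEAST e. ?Q e) \<le> local_code b j"
      using LeastI[of ?Q "local_code b j"] Least_le[of ?Q "local_code b j"] by blast+
    moreover have "local_code b j < node_bound (node_bound j)"
      using ln node_bound by (simp add: local_node_def)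
    ultimately have "P j (E j)" using False by (auto simp: E_def)
    then obtain g where g: "g \<in> G" "E j = local_code g j"
        "c j ((\<lambda>y. interleave (v y))(x := entry (E j))) \<in> S"
      unfolding P_def local_node_iff by blast
    then show ?thesis using \<kappa>_entry[OF g(1)] False by auto
  qed
  then obtain gs0 where gs0: "\<And>j. j \<in> reps \<Longrightarrow> gs0 j \<in> G \<and> E j = local_code (gs0 j) j \<and>
      (j \<in> F0 \<longrightarrow> gs0 j = b) \<and> (j \<notin> F0 \<longrightarrow> \<kappa> (gs0 j) j \<in> S)"
    by metis
  define gs where "gs j = (if j \<in> reps then gs0 j else id)" for j
  have gsG: "gs j \<in> G" for j using gs0 id_G by (simp add: gs_def)
  obtain b' where b': "b' \<in> G" "\<And>i. b' i = gs (orb_rep i) i"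
    using glue[of gs, OF gsG] by metis
  have "b' i = entry (E (orb_rep i)) (2 * i)" for i
  proof -
    have rep: "orb_rep i \<in> reps" by (simp add: reps_def)
    then have "entry (E (orb_rep i)) (2 * i) = interleave (gs (orb_rep i)) (2 * i)"
      using gs0[OF rep] agree_on_local_code[of "orb_rep i" "gs0 (orb_rep i)"] in_orb_rep[of i]
      by (simp add: agree_on_def gs_def)
    then show ?thesis using b'(2) by simp
  qed
  \<comment> \<open>To compute the value at \<open>i\<close>, find the representative of its orbit,
    then the string chosen there, and read position \<open>2 * i\<close>.\<close>
  then have b'_eq: "b' = (\<lambda>i. entry (E (orb_rep i)) (2 * i))" by blast
  have "b' \<le>\<^sub>T f"
    unfolding b'_eq by (intro turing_intros turing_le_comp[OF Ef] f)
  have \<kappa>': "\<kappa> b' j = \<kappa> (gs0 j) j" if "j \<in> reps" for j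
    using colour_glue[where v = v and j = j and x = x, OF c(1) v b'(1) gsG[of j]] b'(2) orb_rep_reps[OF that] that
    by (simp add: \<kappa>_def gs_def)
  have \<kappa>'F: "j \<in> F0 \<Longrightarrow> \<kappa> b' j = \<kappa> b j" and \<kappa>'S: "j \<in> reps \<Longrightarrow> j \<notin> F0 \<Longrightarrow> \<kappa> b' j \<in> S" for j
    using \<kappa>'[of j] gs0[of j] F0(1) by auto
  have "similar c N (v(x := b)) (v(x := b'))"
    unfolding similar_def
  proof
    fix i
    have cc: "colour_class c (v(x := g)) i = {j \<in> reps. \<kappa> g j = i}" for g
      by (simp add: colour_class_def \<kappa>_def)
    show "trunc_card N (colour_class c (v(x := b)) i) = trunc_card N (colour_class c (v(x := b')) i)"
    proof (cases "i \<in> S")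
      case True
      \<comment> \<open>The sample alone contains \<open>N\<close> orbits of a frequent colour, and
        the new witness keeps their colours.\<close>
      have "trunc_card N {a \<in> F0. \<kappa> b a = i} \<le> trunc_card N {j \<in> reps. \<kappa> b' j = i}"
        using F0(1) \<kappa>'F by (intro trunc_card_mono) auto
      moreover have "trunc_card N {a \<in> F0. \<kappa> b a = i} = N"
        using F0(2,4) True by (simp add: trunc_card_def[of N "{a \<in> F0. \<kappa> b a = i}"] S_def)
      ultimately have "trunc_card N {j \<in> reps. \<kappa> b' j = i} = N"
        using trunc_card_le[of N "{j \<in> reps. \<kappa> b' j = i}"] by simp
      then show ?thesis using True unfolding cc by (simp add: S_def)
    next
      case False
      \<comment> \<open>Under either witness a rare colour occurs only inside \<open>F0\<close>,
        where the colours coincide.\<close>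
      then have "\<kappa> b j = i \<longleftrightarrow> \<kappa> b' j = i" if "j \<in> reps" for j
        using small[OF that] \<kappa>'F[of j] \<kappa>'S[OF that] by (cases "j \<in> F0") auto
      then have "{j \<in> reps. \<kappa> b j = i} = {j \<in> reps. \<kappa> b' j = i}"
        by auto
      then show ?thesis unfolding cc by simp
    qed
  qed
  then have "satisfies GG (v(x := b')) \<phi>"
    using decidesD[OF c(2), of "v(x := b)" "v(x := b')"] v b b'(1) by simp
  with b'(1) \<open>b' \<le>\<^sub>T f\<close> show ?thesis by (rule that)
qed

text \<open>Only the existential case needs \<open>TV\<close>. That condition restricts just the
  free variables, since the assignment may leave \<open>A\<close> elsewhere.\<close>

lemma satisfies_Tarski_Vaught:
  assumes A: "subgroup A S_inf" "A \<subseteq> G"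
    and TV: "\<And>v x \<phi> b. (\<And>y. y \<in> free_vars (FEx x \<phi>) \<Longrightarrow> v y \<in> A) \<Longrightarrow> b \<in> G \<Longrightarrow>
      satisfies GG (v(x := b)) \<phi> \<Longrightarrow> \<exists>a\<in>A. satisfies GG (v(x := a)) \<phi>"
  shows "(\<And>y. y \<in> free_vars \<phi> \<Longrightarrow> v y \<in> A) \<Longrightarrow>
    satisfies (S_inf\<lparr>carrier := A\<rparr>) v \<phi> = satisfies GG v \<phi>"
proof (induction \<phi> arbitrary: v)
  case (FEq s t)
  have "term_val (S_inf\<lparr>carrier := A\<rparr>) v r = term_val GG v r" if "\<And>y. y \<in> term_vars r \<Longrightarrow> v y \<in> A" for r
    using term_val_subgroup[OF A(1), of r v] term_val_subgroup[OF subgroup_G, of r v] that A(2)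
    by (metis subsetD)
  then show ?case using FEq by simp
next
  case (FNot \<phi>)
  then show ?case by simp
next
  case (FAnd \<phi> \<psi>)
  then show ?case using FAnd.IH[of v] by simp
next
  case (FEx x \<phi>)
  have IH: "satisfies (S_inf\<lparr>carrier := A\<rparr>) (v(x := a)) \<phi> = satisfies GG (v(x := a)) \<phi>" if "a \<in> A" for a
    using FEx.prems that by (intro FEx.IH) auto
  have "(\<exists>b\<in>G. satisfies GG (v(x := b)) \<phi>) \<longleftrightarrow> (\<exists>a\<in>A. satisfies GG (v(x := a)) \<phi>)"
    using TV[of x \<phi> v] FEx.prems A(2) by blast
  then show ?case using IH by simp
qed

end

section \<open>Turing ideals and elementarity\<close>

lemma deg_le_iff: "deg f \<le> deg g \<longleftrightarrow> f \<le>\<^sub>T g"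
  by (rule less_eq_turing_degree.abs_eq)

lemma turing_ideal_downward: "turing_ideal I \<Longrightarrow> deg g \<in> I \<Longrightarrow> f \<le>\<^sub>T g \<Longrightarrow> deg f \<in> I"
  by (auto simp: turing_ideal_def deg_le_iff)

lemma turing_ideal_join: "turing_ideal I \<Longrightarrow> deg f \<in> I \<Longrightarrow> deg g \<in> I \<Longrightarrow> deg (turing_join f g) \<in> I"
  unfolding sup_turing_degree.abs_eq[symmetric] by (simp add: turing_ideal_def)

text \<open>Iterated joins yield one oracle in the ideal for the tree and the finitely many
  parameters of a formula.\<close>

lemma turing_ideal_upper_bound:
  assumes "turing_ideal I" "deg f \<in> I" "finite S" "\<And>y. y \<in> S \<Longrightarrow> deg (v y) \<in> I"
  obtains h where "deg h \<in> I" "f \<le>\<^sub>T h" "\<And>y. y \<in> S \<Longrightarrow> v y \<le>\<^sub>T h"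
proof -
  have "\<exists>h. deg h \<in> I \<and> f \<le>\<^sub>T h \<and> (\<forall>y\<in>S. v y \<le>\<^sub>T h)"
    using assms(3,4)
  proof (induction rule: finite_induct)
    case empty
    then show ?case using assms(2) turing_le_refl by blast
  next
    case (insert z S)
    then obtain h where "deg h \<in> I" "f \<le>\<^sub>T h" "\<forall>y\<in>S. v y \<le>\<^sub>T h" by auto
    then show ?case
      using turing_ideal_join[OF assms(1), of h "v z"] insert.prems turing_le_join1[of h "v z"]
        turing_le_join2[of "v z" h] by (intro exI[of _ "turing_join h (v z)"]) (auto intro: turing_le_trans)
  qed
  then show ?thesis using that by blast
qed

context independent_orbits
begin

text \<open>The identity is computable from any oracle, an inverse from the permutation itself, and
  a product from the join of its factors.\<close>

lemma subgroup_ideal_part: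
  assumes "turing_ideal I"
  shows "subgroup (ideal_part G I) S_inf"
proof (rule group.subgroupI[OF group_BijGroup])
  show "ideal_part G I \<subseteq> carrier S_inf"
    using subgroup.subset[OF subgroup_G] by (auto simp: ideal_part_def)
  obtain f where "deg f \<in> I"
    using assms unfolding turing_ideal_def by (metis Quotient3_turing_degree Quotient3_abs_rep ex_in_conv)
  then have "deg id \<in> I"
    using turing_ideal_downward[OF assms] turing_le_id[of f] by (simp add: id_def)
  then show "ideal_part G I \<noteq> {}" using id_G by (auto simp: ideal_part_def)
next
  fix a assume a: "a \<in> ideal_part G I"
  then have "inv_into UNIV a \<le>\<^sub>T a" by (intro turing_le_inv turing_le_refl bij_G) (simp add: ideal_part_def)
  then show "inv\<^bsub>S_inf\<^esub> a \<in> ideal_part G I"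
    using a turing_ideal_downward[OF assms, of a] by (simp add: ideal_part_def inv_S_inf bij_G inv_G)
next
  fix a b assume ab: "a \<in> ideal_part G I" "b \<in> ideal_part G I"
  have "(\<lambda>n. a (b n)) \<le>\<^sub>T turing_join a b"
    by (rule turing_le_comp[OF turing_le_join1 turing_le_join2])
  then have "deg (a \<circ> b) \<in> I"
    using ab turing_ideal_downward[OF assms turing_ideal_join[OF assms, of a b]] by (simp add: ideal_part_def o_def)
  then show "a \<otimes>\<^bsub>S_inf\<^esub> b \<in> ideal_part G I"
    using ab by (simp add: ideal_part_def mult_S_inf bij_G comp_G)
qed

lemma elementary_ideal_part:
  assumes I: "turing_ideal I" and T: "deg_tree (perm_tree G) \<in> I"
  shows "elementary_subgroup (ideal_part G I) GG"
proof -
  let ?A = "ideal_part G I"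
  have A: "subgroup ?A S_inf" "?A \<subseteq> G"
    using subgroup_ideal_part[OF I] by (auto simp: ideal_part_def)
  have "\<exists>a\<in>?A. satisfies GG (v(x := a)) \<phi>"
    if v: "\<And>y. y \<in> free_vars (FEx x \<phi>) \<Longrightarrow> v y \<in> ?A" and b: "b \<in> G" "satisfies GG (v(x := b)) \<phi>"
    for v x \<phi> b
  proof -
    let ?V = "free_vars (FEx x \<phi>)"
    obtain h where h: "deg h \<in> I" "tree_fn \<le>\<^sub>T h" "\<And>y. y \<in> ?V \<Longrightarrow> v y \<le>\<^sub>T h"
      using v T by (auto simp: ideal_part_def deg_tree_oracle simp del: free_vars.simps
          intro: turing_ideal_upper_bound[OF I _ finite_free_vars])
    \<comment> \<open>\<open>computable_witness\<close> wants every variable to have a value in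
      \<open>G\<close> computable from \<open>h\<close>; resetting the variables outside
      \<open>?V\<close> to \<open>id\<close> achieves this without affecting satisfaction.\<close>
    define w where "w y = (if y \<in> ?V then v y else id)" for y
    have cong: "satisfies GG (v(x := a)) \<phi> = satisfies GG (w(x := a)) \<phi>" for a
      by (rule satisfies_cong) (simp add: w_def)
    have "w y \<in> G" "w y \<le>\<^sub>T h" for y
      using v[of y] h(3)[of y] id_G turing_le_id[of h] by (auto simp: w_def ideal_part_def id_def)
    then obtain a where "a \<in> G" "a \<le>\<^sub>T h" "satisfies GG (w(x := a)) \<phi>"
      using computable_witness[OF h(2), of w b x \<phi>] b cong by blast
    then show ?thesis
      using cong turing_ideal_downward[OF I h(1)] by (auto simp: ideal_part_def)
  qed
  from satisfies_Tarski_Vaught[OF A this] show ?thesis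
    unfolding elementary_subgroup_def
    using group.subgroup_incl[OF group_BijGroup A(1) subgroup_G A(2)] by simp
qed

end

theorem theorem6:
  fixes G :: "(nat \<Rightarrow> nat) set" and I :: "turing_degree set"
  assumes "profinite_subgroup G"
    and "orbit_independent G"
    and "scott_ideal I"
    and "deg_tree (perm_tree G) \<in> I"
  shows "elementary_subgroup (ideal_part G I) (S_inf\<lparr>carrier := G\<rparr>)"
proof -
  interpret independent_orbits G
    using assms(1,2) by (simp add: independent_orbits_def profinite_subgroup_def)
  show ?thesis
    using assms(3,4) by (intro elementary_ideal_part) (simp_all add: scott_ideal_def)
qed

end
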